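(* Let $X$ be an $L^1$-predual space with property $(\ddagger)$. Then for every $x\in S(X)$, $x$ is a $k$-smooth point for some integer $k>0$ (depending on $x$).
   Context: All Banach spaces are complex. For a Banach space $X$, $B(X)$ and $S(X)$ denote its closed unit ball and unit sphere and $X^*$ its dual. $X$ is an $L^1$-predual space if $X^*$ is isometric to $L^1(\mu)$ for some positive measure $\mu$. A non-zero $x\in X$ is a $k$-smooth point if the set $J(x)=\{f\in S(X^* ): f(x)=\|x\|\}$ satisfies $\dim(\mathrm{span}\,J(x))=k$. A functional $\phi\in X^*$ is norm-attaining if there is $x\in B(X)$ with $|\phi(x)|=\|\phi\|$. $X$ has property $(\ddagger)$ if for every $0<\varepsilon<2$ the following holds: whenever $\{\phi_\alpha\}$ is a net of norm-attaining functionals in $B(X^* )$ with $\|\phi_\alpha-\phi_\beta\|\ge\varepsilon$ for all $\alpha\ne\beta$, and $\phi\in B(X^* )$ is norm-attaining with $\phi_\alpha\to\phi$ in the weak* topology, then $\|\phi\|\le 1-\varepsilon/2$. In this definition nets are indexed by directed sets without a greatest element. *)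

theory Defs
  imports "HOL-Analysis.Analysis"
begin

section \<open>Complex Banach spaces\<close>

class complex_banach = banach +
  fixes scaleC :: "complex \<Rightarrow> 'a \<Rightarrow> 'a" (infixr "*\<^sub>C" 75)
  assumes scaleC_add_right: "c *\<^sub>C (x + y) = c *\<^sub>C x + c *\<^sub>C y"
    and scaleC_add_left: "(c + d) *\<^sub>C x = c *\<^sub>C x + d *\<^sub>C x"
    and scaleC_scaleC: "c *\<^sub>C d *\<^sub>C x = (c * d) *\<^sub>C x"
    and scaleC_of_real: "complex_of_real r *\<^sub>C x = r *\<^sub>R x"
    and norm_scaleC: "norm (c *\<^sub>C x) = cmod c * norm x"

lemma scaleC_one: "1 *\<^sub>C x = (x::'a::complex_banach)"
  using scaleC_of_real[of 1 x] by simp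

global_interpretation complex_vector:
  vector_space "scaleC :: complex \<Rightarrow> 'a \<Rightarrow> 'a::complex_banach"
  by unfold_locales
    (simp_all add: scaleC_add_right scaleC_add_left scaleC_scaleC scaleC_one)

instantiation complex :: complex_banach
begin

definition scaleC_complex :: "complex \<Rightarrow> complex \<Rightarrow> complex"
  where "scaleC_complex c z = c * z"

instance
  by standard (simp_all add: scaleC_complex_def algebra_simps norm_mult scaleR_conv_of_real)

end

instantiation blinfun :: (real_normed_vector, complex_banach) complex_banach
begin

definition scaleC_blinfun :: "complex \<Rightarrow> ('a \<Rightarrow>\<^sub>L 'b) \<Rightarrow> 'a \<Rightarrow>\<^sub>L 'b"
  where "scaleC_blinfun c f = Blinfun (\<lambda>x. c *\<^sub>C blinfun_apply f x)"

lemma bounded_linear_scaleC: "bounded_linear (\<lambda>x::'b. c *\<^sub>C x)"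
proof (rule bounded_linear_intro)
  fix r :: real and x :: 'b
  have "c *\<^sub>C r *\<^sub>R x = complex_of_real r *\<^sub>C c *\<^sub>C x"
    unfolding scaleC_of_real[symmetric] scaleC_scaleC by (simp add: mult.commute)
  then show "c *\<^sub>C r *\<^sub>R x = r *\<^sub>R c *\<^sub>C x"
    by (simp only: scaleC_of_real)
  show "norm (c *\<^sub>C x) \<le> norm x * cmod c"
    by (simp add: norm_scaleC mult.commute)
qed (rule scaleC_add_right)

lemma blinfun_apply_scaleC:
  "blinfun_apply (c *\<^sub>C f) x = c *\<^sub>C blinfun_apply (f :: 'a \<Rightarrow>\<^sub>L 'b) x"
  unfolding scaleC_blinfun_def
  by (subst bounded_linear_Blinfun_apply)
    (auto intro!: bounded_linear_compose[OF bounded_linear_scaleC blinfun.bounded_linear_right])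

instance
proof
  fix c d :: complex and r :: real and f g :: "'a \<Rightarrow>\<^sub>L 'b"
  show "c *\<^sub>C (f + g) = c *\<^sub>C f + c *\<^sub>C g"
    by (rule blinfun_eqI) (simp add: blinfun_apply_scaleC blinfun.add_left scaleC_add_right)
  show "(c + d) *\<^sub>C f = c *\<^sub>C f + d *\<^sub>C f"
    by (rule blinfun_eqI) (simp add: blinfun_apply_scaleC blinfun.add_left scaleC_add_left)
  show "c *\<^sub>C d *\<^sub>C f = (c * d) *\<^sub>C f"
    by (rule blinfun_eqI) (simp add: blinfun_apply_scaleC scaleC_scaleC)
  show "complex_of_real r *\<^sub>C f = r *\<^sub>R f"
    by (rule blinfun_eqI) (simp add: blinfun_apply_scaleC blinfun.scaleR_left scaleC_of_real)
  have le: "norm (a *\<^sub>C h) \<le> cmod a * norm h" for a and h :: "'a \<Rightarrow>\<^sub>L 'b"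
  proof (rule norm_blinfun_bound)
    show "norm (blinfun_apply (a *\<^sub>C h) x) \<le> cmod a * norm h * norm x" for x
      using mult_left_mono[OF norm_blinfun[of h x] norm_ge_zero[of a]]
      by (simp add: blinfun_apply_scaleC norm_scaleC mult.assoc)
  qed simp
  show "norm (c *\<^sub>C f) = cmod c * norm f"
  proof (cases "c = 0")
    case True
    then show ?thesis
      using le[of c f] by simp
  next
    case False
    have "inverse c *\<^sub>C c *\<^sub>C f = f"
    proof (rule blinfun_eqI)
      show "blinfun_apply (inverse c *\<^sub>C c *\<^sub>C f) x = blinfun_apply f x" for x
        using False by (simp add: blinfun_apply_scaleC scaleC_scaleC scaleC_one)
    qed
    then have "norm f \<le> inverse (cmod c) * norm (c *\<^sub>C f)"
      using le[of "inverse c" "c *\<^sub>C f"] by (simp add: norm_inverse)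
    then have "cmod c * norm f \<le> norm (c *\<^sub>C f)"
      using False by (simp add: field_simps)
    with le[of c f] show ?thesis
      by simp
  qed
qed

end


section \<open>The dual space\<close>

text \<open>
  The type \<open>'a \<Rightarrow>\<^sub>L complex\<close> consists of the bounded real-linear maps; the dual is the
  closed complex subspace of the complex-linear ones, with the operator norm.
\<close>

definition dual :: "('a::complex_banach \<Rightarrow>\<^sub>L complex) set"
  where "dual = {\<phi>. \<forall>c x. blinfun_apply \<phi> (c *\<^sub>C x) = c * blinfun_apply \<phi> x}"

definition weak_star_topology :: "('a::complex_banach \<Rightarrow>\<^sub>L complex) topology"
  where "weak_star_topology = pullback_topology dual blinfun_apply euclidean"

definition norm_attaining :: "('a::complex_banach \<Rightarrow>\<^sub>L complex) \<Rightarrow> bool"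
  where "norm_attaining \<phi> \<longleftrightarrow> (\<exists>x\<in>cball 0 1. cmod (blinfun_apply \<phi> x) = norm \<phi>)"

definition J_set :: "'a::complex_banach \<Rightarrow> ('a \<Rightarrow>\<^sub>L complex) set"
  where "J_set x = {f \<in> dual. norm f = 1 \<and> blinfun_apply f x = complex_of_real (norm x)}"

text \<open>
  The finite spanning set is required because \<open>dim\<close> is 0 on infinite-dimensional spaces.
\<close>

definition k_smooth_point :: "nat \<Rightarrow> 'a::complex_banach \<Rightarrow> bool"
  where "k_smooth_point k x \<longleftrightarrow>
    x \<noteq> 0 \<and>
    (\<exists>B. finite B \<and> complex_vector.span B = complex_vector.span (J_set x)) \<and>
    complex_vector.dim (complex_vector.span (J_set x)) = k"


section \<open>\<open>L\<^sup>1\<close>-predual spaces\<close>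

definition L1_eq :: "'b measure \<Rightarrow> (('b \<Rightarrow> complex) \<times> ('b \<Rightarrow> complex)) set"
  where "L1_eq M = {(f, g). integrable M f \<and> integrable M g \<and> (AE t in M. f t = g t)}"

definition L1 :: "'b measure \<Rightarrow> ('b \<Rightarrow> complex) set set"
  where "L1 M = {f. integrable M f} // L1_eq M"

text \<open>
  A surjective complex-linear isometry from the dual onto \<open>L1 M\<close>. The vector space
  operations and the norm of \<open>L1 M\<close> are expressed through representatives.
\<close>

definition dual_L1_isometry ::
    "'b measure \<Rightarrow> (('a::complex_banach \<Rightarrow>\<^sub>L complex) \<Rightarrow> ('b \<Rightarrow> complex) set) \<Rightarrow> bool"
  where "dual_L1_isometry M T \<longleftrightarrow>
    bij_betw T dual (L1 M) \<and>
    (\<forall>\<phi>\<in>dual. \<forall>\<psi>\<in>dual. \<forall>f\<in>T \<phi>. \<forall>g\<in>T \<psi>. (\<lambda>t. f t + g t) \<in> T (\<phi> + \<psi>)) \<and>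
    (\<forall>c. \<forall>\<phi>\<in>dual. \<forall>f\<in>T \<phi>. (\<lambda>t. c * f t) \<in> T (c *\<^sub>C \<phi>)) \<and>
    (\<forall>\<phi>\<in>dual. \<forall>f\<in>T \<phi>. (\<integral>t. cmod (f t) \<partial>M) = norm \<phi>)"

definition L1_predual :: "'a::complex_banach itself \<Rightarrow> 'b measure \<Rightarrow> bool"
  where "L1_predual X M \<longleftrightarrow>
    (\<exists>T :: ('a \<Rightarrow>\<^sub>L complex) \<Rightarrow> ('b \<Rightarrow> complex) set. dual_L1_isometry M T)"


section \<open>Nets and property \<open>(\<ddagger>)\<close>\<close>

definition directed_set :: "'i set \<Rightarrow> ('i \<times> 'i) set \<Rightarrow> bool"
  where "directed_set D r \<longleftrightarrow>
    D \<noteq> {} \<and> preorder_on D r \<and> (\<forall>a\<in>D. \<forall>b\<in>D. \<exists>c\<in>D. (a, c) \<in> r \<and> (b, c) \<in> r)"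

definition has_greatest :: "'i set \<Rightarrow> ('i \<times> 'i) set \<Rightarrow> bool"
  where "has_greatest D r \<longleftrightarrow> (\<exists>g\<in>D. \<forall>d\<in>D. (d, g) \<in> r)"

definition tails :: "'i set \<Rightarrow> ('i \<times> 'i) set \<Rightarrow> 'i filter"
  where "tails D r = (INF d\<in>D. principal (r `` {d}))"

definition ddagger_nets :: "'i itself \<Rightarrow> 'a::complex_banach itself \<Rightarrow> bool"
  where "ddagger_nets I X \<longleftrightarrow>
    (\<forall>\<epsilon>::real. 0 < \<epsilon> \<and> \<epsilon> < 2 \<longrightarrow>
      (\<forall>(D :: 'i set) r (\<Phi> :: 'i \<Rightarrow> 'a \<Rightarrow>\<^sub>L complex) \<phi>.
        directed_set D r \<and> \<not> has_greatest D r \<and>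
        (\<forall>\<alpha>\<in>D. \<Phi> \<alpha> \<in> dual \<inter> cball 0 1 \<and> norm_attaining (\<Phi> \<alpha>)) \<and>
        (\<forall>\<alpha>\<in>D. \<forall>\<beta>\<in>D. \<alpha> \<noteq> \<beta> \<longrightarrow> norm (\<Phi> \<alpha> - \<Phi> \<beta>) \<ge> \<epsilon>) \<and>
        \<phi> \<in> dual \<inter> cball 0 1 \<and> norm_attaining \<phi> \<and>
        limitin weak_star_topology \<Phi> \<phi> (tails D r) \<longrightarrow>
        norm \<phi> \<le> 1 - \<epsilon> / 2))"

text \<open>
  The separation condition makes every net in question injective, so it can be reindexed by
  its own set of values. Hence nets indexed by subsets of \<open>'a \<Rightarrow>\<^sub>L complex\<close> cover all
  index types; see \<open>property_ddagger_any_index\<close> below.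
\<close>

definition property_ddagger :: "'a::complex_banach itself \<Rightarrow> bool"
  where "property_ddagger X \<longleftrightarrow> ddagger_nets TYPE('a \<Rightarrow>\<^sub>L complex) X"

lemma eventually_tails:
  assumes "directed_set D r"
  shows "eventually P (tails D r) \<longleftrightarrow> (\<exists>d\<in>D. \<forall>e. (d, e) \<in> r \<longrightarrow> P e)"
proof -
  have tr: "trans r"
    using assms by (auto simp: directed_set_def preorder_on_def)
  have "\<exists>c\<in>D. principal (r `` {c}) \<le> inf (principal (r `` {a})) (principal (r `` {b}))"
    if "a \<in> D" "b \<in> D" for a b
  proof -
    obtain c where "c \<in> D" "(a, c) \<in> r" "(b, c) \<in> r"
      using assms \<open>a \<in> D\<close> \<open>b \<in> D\<close> unfolding directed_set_def by blast
    then show ?thesis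
      using transD[OF tr] by (intro bexI[of _ c]) auto
  qed
  then have "eventually P (INF d\<in>D. principal (r `` {d}))
      \<longleftrightarrow> (\<exists>d\<in>D. eventually P (principal (r `` {d})))"
    using assms by (intro eventually_INF_base) (auto simp: directed_set_def)
  then show ?thesis
    by (auto simp: tails_def eventually_principal)
qed

lemma limitin_weak_star:
  assumes "\<phi> \<in> dual" "eventually (\<lambda>i. \<Phi> i \<in> dual) F"
  shows "limitin weak_star_topology \<Phi> \<phi> F \<longleftrightarrow>
    (\<forall>x. ((\<lambda>i. blinfun_apply (\<Phi> i) x) \<longlongrightarrow> blinfun_apply \<phi> x) F)"
proof -
  have "limitin weak_star_topology \<Phi> \<phi> F \<longleftrightarrow>
      (\<forall>V. open V \<and> blinfun_apply \<phi> \<in> V \<longrightarrow> eventually (\<lambda>i. blinfun_apply (\<Phi> i) \<in> V) F)"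
    (is "?L \<longleftrightarrow> ?R")
  proof
    assume L: ?L
    show ?R
    proof (intro allI impI)
      fix V :: "('a \<Rightarrow> complex) set"
      assume V: "open V \<and> blinfun_apply \<phi> \<in> V"
      have "openin weak_star_topology (blinfun_apply -` V \<inter> dual)"
        using V unfolding weak_star_topology_def openin_pullback_topology by auto
      with L V assms(1) have "eventually (\<lambda>i. \<Phi> i \<in> blinfun_apply -` V \<inter> dual) F"
        unfolding limitin_def by blast
      then show "eventually (\<lambda>i. blinfun_apply (\<Phi> i) \<in> V) F"
        by (rule eventually_mono) auto
    qed
  next
    assume R: ?R
    show ?L
      unfolding limitin_def
    proof (intro conjI allI impI)
      show "\<phi> \<in> topspace weak_star_topology"
        using assms(1) by (simp add: weak_star_topology_def topspace_pullback_topology)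
    next
      fix U
      assume U: "openin weak_star_topology U \<and> \<phi> \<in> U"
      then obtain V where V: "open V" "U = blinfun_apply -` V \<inter> dual"
        unfolding weak_star_topology_def openin_pullback_topology by auto
      with R U have "eventually (\<lambda>i. blinfun_apply (\<Phi> i) \<in> V) F"
        by blast
      with assms(2) show "eventually (\<lambda>i. \<Phi> i \<in> U) F"
        by eventually_elim (use V in auto)
    qed
  qed
  also have "\<dots> \<longleftrightarrow> ((\<lambda>i. blinfun_apply (\<Phi> i)) \<longlongrightarrow> blinfun_apply \<phi>) F"
    by (auto simp: tendsto_def)
  also have "\<dots> \<longleftrightarrow> (\<forall>x. ((\<lambda>i. blinfun_apply (\<Phi> i) x) \<longlongrightarrow> blinfun_apply \<phi> x) F)"
    using limitin_componentwise[of "\<lambda>_. euclidean" UNIV "\<lambda>i. blinfun_apply (\<Phi> i)" "blinfun_apply \<phi>" F]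
    by (simp add: euclidean_product_topology)
  finally show ?thesis .
qed

lemma property_ddagger_any_index:
  assumes "property_ddagger TYPE('a::complex_banach)"
  shows "ddagger_nets TYPE('i) TYPE('a)"
  unfolding ddagger_nets_def
proof (intro allI impI, elim conjE)
  fix \<epsilon> :: real and D :: "'i set" and r and \<Phi> :: "'i \<Rightarrow> 'a \<Rightarrow>\<^sub>L complex" and \<phi>
  assume eps: "0 < \<epsilon>" "\<epsilon> < 2"
    and dir: "directed_set D r" and ng: "\<not> has_greatest D r"
    and ball: "\<forall>\<alpha>\<in>D. \<Phi> \<alpha> \<in> dual \<inter> cball 0 1 \<and> norm_attaining (\<Phi> \<alpha>)"
    and sep: "\<forall>\<alpha>\<in>D. \<forall>\<beta>\<in>D. \<alpha> \<noteq> \<beta> \<longrightarrow> \<epsilon> \<le> norm (\<Phi> \<alpha> - \<Phi> \<beta>)"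
    and phi: "\<phi> \<in> dual \<inter> cball 0 1" "norm_attaining \<phi>"
    and lim: "limitin weak_star_topology \<Phi> \<phi> (tails D r)"
  define E where "E = \<Phi> ` D"
  define s where "s = map_prod \<Phi> \<Phi> ` r"
  have inj: "\<alpha> = \<beta>" if "\<alpha> \<in> D" "\<beta> \<in> D" "\<Phi> \<alpha> = \<Phi> \<beta>" for \<alpha> \<beta>
    using sep eps that by fastforce
  have rD: "r \<subseteq> D \<times> D" and refl: "refl_on D r" and tr: "trans r" and ne: "D \<noteq> {}"
    and ub: "\<forall>a\<in>D. \<forall>b\<in>D. \<exists>c\<in>D. (a, c) \<in> r \<and> (b, c) \<in> r"
    using dir by (auto simp: directed_set_def preorder_on_def)
  have s_iff: "(\<Phi> a, \<Phi> b) \<in> s \<longleftrightarrow> (a, b) \<in> r" if "a \<in> D" "b \<in> D" for a b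
  proof
    assume "(\<Phi> a, \<Phi> b) \<in> s"
    then obtain a' b' where *: "(a', b') \<in> r" "\<Phi> a = \<Phi> a'" "\<Phi> b = \<Phi> b'"
      by (auto simp: s_def)
    then have "a' = a" "b' = b"
      using rD inj[of a a'] inj[of b b'] that by auto
    with * show "(a, b) \<in> r" by simp
  qed (force simp: s_def)
  have sE: "s \<subseteq> E \<times> E"
    using rD by (auto simp: s_def E_def)
  have "refl_on E s"
    using refl by (auto simp: refl_on_def E_def s_iff)
  moreover have "trans s"
  proof (rule transI)
    fix u v w assume uv: "(u, v) \<in> s" and vw: "(v, w) \<in> s"
    with sE obtain a b c where "a \<in> D" "b \<in> D" "c \<in> D" "u = \<Phi> a" "v = \<Phi> b" "w = \<Phi> c"
      unfolding E_def by blast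
    with uv vw show "(u, w) \<in> s"
      using transD[OF tr, of a b c] by (simp add: s_iff)
  qed
  moreover have "\<forall>u\<in>E. \<forall>v\<in>E. \<exists>w\<in>E. (u, w) \<in> s \<and> (v, w) \<in> s"
  proof (intro ballI)
    fix u v assume "u \<in> E" "v \<in> E"
    then obtain a b where ab: "a \<in> D" "b \<in> D" "u = \<Phi> a" "v = \<Phi> b"
      unfolding E_def by blast
    with ub obtain c where "c \<in> D" "(a, c) \<in> r" "(b, c) \<in> r"
      by blast
    with ab show "\<exists>w\<in>E. (u, w) \<in> s \<and> (v, w) \<in> s"
      by (intro bexI[of _ "\<Phi> c"]) (simp_all add: s_iff E_def)
  qed
  ultimately have dirE: "directed_set E s"
    using sE ne by (auto simp: directed_set_def preorder_on_def E_def)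
  have ngE: "\<not> has_greatest E s"
  proof
    assume "has_greatest E s"
    then obtain g where "g \<in> D" "\<forall>d\<in>D. (\<Phi> d, \<Phi> g) \<in> s"
      unfolding has_greatest_def E_def by blast
    then have "has_greatest D r"
      unfolding has_greatest_def by (intro bexI[of _ g]) (simp_all add: s_iff)
    with ng show False ..
  qed
  have "limitin weak_star_topology (\<lambda>u. u) \<phi> (tails E s)"
    unfolding limitin_def
  proof (intro conjI allI impI)
    show "\<phi> \<in> topspace weak_star_topology"
      using lim by (simp add: limitin_def)
    fix U assume "openin weak_star_topology U \<and> \<phi> \<in> U"
    with lim obtain d where d: "d \<in> D" "\<And>e. (d, e) \<in> r \<Longrightarrow> \<Phi> e \<in> U"
      unfolding limitin_def eventually_tails[OF dir] by blast
    have "\<forall>v. (\<Phi> d, v) \<in> s \<longrightarrow> v \<in> U"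
    proof (intro allI impI)
      fix v assume v: "(\<Phi> d, v) \<in> s"
      with sE obtain e where "e \<in> D" "v = \<Phi> e" unfolding E_def by blast
      with v d show "v \<in> U" by (simp add: s_iff)
    qed
    moreover have "\<Phi> d \<in> E"
      using d(1) by (simp add: E_def)
    ultimately show "eventually (\<lambda>u. u \<in> U) (tails E s)"
      unfolding eventually_tails[OF dirE] by blast
  qed
  moreover have "\<forall>u\<in>E. u \<in> dual \<inter> cball 0 1 \<and> norm_attaining u"
    using ball unfolding E_def by blast
  moreover have "\<forall>u\<in>E. \<forall>v\<in>E. u \<noteq> v \<longrightarrow> \<epsilon> \<le> norm (u - v)"
  proof (intro ballI impI)
    fix u v assume uv: "u \<in> E" "v \<in> E" "u \<noteq> v"
    then obtain a b where "a \<in> D" "b \<in> D" "u = \<Phi> a" "v = \<Phi> b"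
      unfolding E_def by blast
    with sep uv(3) show "\<epsilon> \<le> norm (u - v)"
      by auto
  qed
  ultimately have "directed_set E s \<and> \<not> has_greatest E s \<and>
      (\<forall>u\<in>E. u \<in> dual \<inter> cball 0 1 \<and> norm_attaining u) \<and>
      (\<forall>u\<in>E. \<forall>v\<in>E. u \<noteq> v \<longrightarrow> \<epsilon> \<le> norm (u - v)) \<and>
      \<phi> \<in> dual \<inter> cball 0 1 \<and> norm_attaining \<phi> \<and>
      limitin weak_star_topology (\<lambda>u. u) \<phi> (tails E s)"
    using dirE ngE phi by (simp only: simp_thms)
  with assms[unfolded property_ddagger_def ddagger_nets_def, THEN spec[where x = \<epsilon>],
      THEN mp[OF _ conjI[OF eps]], THEN spec[where x = E], THEN spec[where x = s],
      THEN spec[where x = "\<lambda>u. u"], THEN spec[where x = \<phi>]]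
  show "norm \<phi> \<le> 1 - \<epsilon> / 2"
    by (rule mp)
qed

end

theory Submission
  imports Defs
begin

text \<open>
  Fix a unit vector \<open>x\<close>. The set \<open>J_set x\<close> is a weak* compact convex face of the dual unit ball,
  every member attains its norm at \<open>x\<close>, and every member has norm 1. Property \<open>(\<ddagger>)\<close>, applied to
  nets indexed by the natural numbers, therefore leaves no room for a sequence in the face that
  converges weak* to a member of the face while staying separated in norm: on the face, weak*
  convergence of sequences implies norm convergence (\<open>ddagger_weak_star_imp_norm\<close>). The claim is
  that a face spanning an infinite-dimensional space violates this.

  The \<open>L\<^sup>1\<close> structure is used once, to produce many far apart functionals. Representatives of
  members of the face have the same phase, and cutting such a representative along a measurable set
  yields two multiples of members of the face. Two distinct members can always be separated by such
  a cut, so an infinite-dimensional face can be cut again and again; this gives a sequence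
  \<open>f\<close> in the face with pairwise disjoint supports (\<open>disjoint_sequence_in_J\<close>).

  Weak* compactness alone gives no convergent subsequence of \<open>f\<close>, because the dual ball need not be
  sequentially compact. The way out is an argument in the spirit of the Hagler--Johnson
  proof of the Josefson--Nissenzweig theorem. Consider all sequences whose \<open>n\<close>-th term is a convex
  combination of the terms of \<open>f\<close> from index \<open>n\<close> on, and their oscillation at points of the unit ball.

  Either the oscillation can be made arbitrarily small by passing to further convex combinations.
  Then a diagonal sequence converges weak*; as the supports are disjoint, its terms do not converge
  in norm (\<open>ddagger_no_disjoint_sequence\<close>).

  Or some sequence \<open>a\<close> keeps oscillating by a fixed \<open>\<delta>\<close>, and so do all its convex combinations
  (\<open>ddagger_no_persistent_oscillation\<close>). Then one averages repeatedly: given \<open>a\<^sub>K\<close>, choose \<open>y\<^sub>K\<close> in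
  the ball and indices \<open>l\<^sub>n\<close>, \<open>h\<^sub>n\<close> at which the values at \<open>y\<^sub>K\<close> differ by \<open>\<delta>\<close>, and let the next
  sequence consist of the midpoints of the \<open>l\<^sub>n\<close>-th and the \<open>h\<^sub>n\<close>-th term. Unfolding the averages, a
  term of \<open>a\<^sub>K\<close> is the mean of a family indexed by \<open>{0,1}\<^sup>K\<close>. Conditioning this mean on the
  \<open>k\<close>-th coordinate being 1 perturbs it by the \<open>k\<close>-th Rademacher coefficient of the family. By
  Bessel's inequality these coefficients are square summable at every point, with a bound
  independent of \<open>K\<close>; at \<open>y\<^sub>k\<close> the \<open>k\<close>-th one is at least \<open>\<delta>/2\<close>. Both facts survive a weak* limit
  \<open>K \<rightarrow> \<infinity>\<close>. In the limit the conditioned means converge weak* to the mean, but not in norm.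
\<close>

section \<open>Supporting functionals\<close>

lemma dual_scaleC_apply: "\<phi> \<in> dual \<Longrightarrow> blinfun_apply \<phi> (c *\<^sub>C y) = c * blinfun_apply \<phi> y"
  by (simp add: dual_def)

lemma dual_add: "\<phi> \<in> dual \<Longrightarrow> \<psi> \<in> dual \<Longrightarrow> \<phi> + \<psi> \<in> dual"
  by (simp add: dual_def blinfun.add_left algebra_simps)

lemma dual_scaleC: "\<phi> \<in> dual \<Longrightarrow> c *\<^sub>C \<phi> \<in> dual"
  by (simp add: dual_def blinfun_apply_scaleC scaleC_complex_def algebra_simps)

lemma dual_scaleR: "\<phi> \<in> dual \<Longrightarrow> r *\<^sub>R \<phi> \<in> dual"
  using dual_scaleC[of \<phi> "complex_of_real r"] by (simp add: scaleC_of_real)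

lemma J_setI:
  assumes "\<phi> \<in> dual" "\<And>y. cmod (blinfun_apply \<phi> y) \<le> norm y"
    and "blinfun_apply \<phi> x = complex_of_real (norm x)" "x \<noteq> 0"
  shows "\<phi> \<in> J_set x"
proof -
  have "norm \<phi> \<le> 1"
    by (rule norm_blinfun_bound) (use assms in auto)
  moreover have "norm x \<le> norm \<phi> * norm x"
    using norm_blinfun[of \<phi> x] assms(3) by simp
  then have "1 \<le> norm \<phi>"
    using assms(4) by simp
  ultimately show ?thesis
    using assms by (simp add: J_set_def)
qed

lemma J_set_bound: "\<phi> \<in> J_set x \<Longrightarrow> cmod (blinfun_apply \<phi> y) \<le> norm y"
  using norm_blinfun[of \<phi> y] by (simp add: J_set_def)

lemma convex_J_set:
  assumes "x \<noteq> 0"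
  shows "convex (J_set x)"
proof (rule convexI)
  fix \<phi> \<psi> and u v :: real
  assume J: "\<phi> \<in> J_set x" "\<psi> \<in> J_set x" and uv: "0 \<le> u" "0 \<le> v" "u + v = 1"
  show "u *\<^sub>R \<phi> + v *\<^sub>R \<psi> \<in> J_set x"
  proof (rule J_setI[OF _ _ _ assms])
    show "u *\<^sub>R \<phi> + v *\<^sub>R \<psi> \<in> dual"
      using J by (simp add: J_set_def dual_add dual_scaleR)
    show "cmod (blinfun_apply (u *\<^sub>R \<phi> + v *\<^sub>R \<psi>) y) \<le> norm y" for y
    proof -
      have "cmod (blinfun_apply (u *\<^sub>R \<phi> + v *\<^sub>R \<psi>) y)
          \<le> u * cmod (blinfun_apply \<phi> y) + v * cmod (blinfun_apply \<psi> y)"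
        using norm_triangle_ineq[of "u *\<^sub>R blinfun_apply \<phi> y" "v *\<^sub>R blinfun_apply \<psi> y"] uv
        by (simp add: blinfun.add_left blinfun.scaleR_left)
      also have "\<dots> \<le> u * norm y + v * norm y"
        using J_set_bound[OF J(1)] J_set_bound[OF J(2)] uv by (intro add_mono mult_left_mono) auto
      also have "\<dots> = norm y"
        using uv by (simp flip: distrib_right)
      finally show ?thesis .
    qed
    have "complex_of_real u + complex_of_real v = 1"
      using uv by (simp flip: of_real_add)
    then show "blinfun_apply (u *\<^sub>R \<phi> + v *\<^sub>R \<psi>) x = complex_of_real (norm x)"
      using J by (simp add: J_set_def blinfun.add_left blinfun.scaleR_left scaleR_conv_of_real
          flip: distrib_right)
  qed
qed

definition sublinear :: "('v::real_vector \<Rightarrow> real) \<Rightarrow> bool"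
  where "sublinear p \<longleftrightarrow>
    (\<forall>y z. p (y + z) \<le> p y + p z) \<and> (\<forall>c>0. \<forall>y. p (c *\<^sub>R y) \<le> c * p y)"

lemma sublinear_add: "sublinear p \<Longrightarrow> p (y + z) \<le> p y + p z"
  by (simp add: sublinear_def)

lemma sublinear_scaleR:
  assumes "sublinear p" "c > 0"
  shows "p (c *\<^sub>R y) = c * p y"
proof (rule antisym)
  show "p (c *\<^sub>R y) \<le> c * p y"
    using assms by (simp add: sublinear_def)
  have "p (inverse c *\<^sub>R c *\<^sub>R y) \<le> inverse c * p (c *\<^sub>R y)"
    using assms unfolding sublinear_def by (meson positive_imp_inverse_positive)
  then show "c * p y \<le> p (c *\<^sub>R y)"
    using assms(2) by (simp add: field_simps)
qed

lemma sublinear_zero: "sublinear p \<Longrightarrow> p 0 = 0"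
  using sublinear_scaleR[of p 2 0] by simp

lemma sublinear_neg: "sublinear p \<Longrightarrow> - p (- y) \<le> p y"
  using sublinear_add[of p y "- y"] by (simp add: sublinear_zero)

text \<open>
  Tilting along \<open>z\<close> yields the largest sublinear minorant of \<open>p\<close> whose value at \<open>- z\<close> is at most
  \<open>- p z\<close>. Hence every linear functional below the tilt agrees with \<open>p\<close> at \<open>z\<close>.
\<close>
definition tilt :: "('v::real_vector \<Rightarrow> real) \<Rightarrow> 'v \<Rightarrow> 'v \<Rightarrow> real"
  where "tilt p z y = (INF t\<in>{0..}. p (y + t *\<^sub>R z) - t * p z)"

text \<open>
  The infimum is finite because \<open>- p (- y)\<close> bounds it from below.
\<close>
lemma tilt_le:
  assumes "sublinear p" "0 \<le> t"
  shows "tilt p z y \<le> p (y + t *\<^sub>R z) - t * p z"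
proof -
  have "- p (- y) \<le> p (y + s *\<^sub>R z) - s * p z" if "0 \<le> s" for s
  proof (cases "s = 0")
    case False
    then have "s * p z = p (s *\<^sub>R z)"
      using that assms(1) by (simp add: sublinear_scaleR)
    then show ?thesis
      using sublinear_add[OF assms(1), of "y + s *\<^sub>R z" "- y"] by simp
  qed (use sublinear_neg[OF assms(1)] in simp)
  then have "bdd_below ((\<lambda>t. p (y + t *\<^sub>R z) - t * p z) ` {0..})"
    by (intro bdd_belowI2[where m = "- p (- y)"]) auto
  then show ?thesis
    unfolding tilt_def using assms(2) by (intro cINF_lower) auto
qed

lemma le_tilt: "(\<And>t. 0 \<le> t \<Longrightarrow> m \<le> p (y + t *\<^sub>R z) - t * p z) \<Longrightarrow> m \<le> tilt p z y"
  unfolding tilt_def by (rule cINF_greatest) auto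

lemma tilt_le_self: "sublinear p \<Longrightarrow> tilt p z y \<le> p y"
  using tilt_le[of p 0 z y] by simp

lemma sublinear_tilt:
  assumes p: "sublinear p"
  shows "sublinear (tilt p z)"
  unfolding sublinear_def
proof (intro conjI allI impI)
  fix y w
  have "tilt p z (y + w) \<le> (p (y + s *\<^sub>R z) - s * p z) + (p (w + t *\<^sub>R z) - t * p z)"
    if "0 \<le> s" "0 \<le> t" for s t
    using tilt_le[OF p, of "s + t" z "y + w"] that
      sublinear_add[OF p, of "y + s *\<^sub>R z" "w + t *\<^sub>R z"]
    by (simp add: algebra_simps)
  then have "tilt p z (y + w) - (p (w + t *\<^sub>R z) - t * p z) \<le> tilt p z y" if "0 \<le> t" for t
    by (intro le_tilt) (use that in \<open>fastforce simp: algebra_simps\<close>)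
  then have "tilt p z (y + w) - tilt p z y \<le> tilt p z w"
    by (intro le_tilt) (fastforce simp: algebra_simps)
  then show "tilt p z (y + w) \<le> tilt p z y + tilt p z w"
    by simp
next
  fix c :: real and y assume c: "c > 0"
  have "tilt p z (c *\<^sub>R y) / c \<le> p (y + t *\<^sub>R z) - t * p z" if "0 \<le> t" for t
  proof -
    have "tilt p z (c *\<^sub>R y) \<le> p (c *\<^sub>R (y + t *\<^sub>R z)) - (c * t) * p z"
      using tilt_le[OF p, of "c * t" z "c *\<^sub>R y"] c that by (simp add: scaleR_add_right)
    then show ?thesis
      unfolding sublinear_scaleR[OF p c] pos_divide_le_eq[OF c]
      by (simp add: right_diff_distrib mult.commute mult.left_commute)
  qed
  then have "tilt p z (c *\<^sub>R y) / c \<le> tilt p z y"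
    by (rule le_tilt)
  then show "tilt p z (c *\<^sub>R y) \<le> c * tilt p z y"
    using c by (simp add: field_simps)
qed

text \<open>
  Zorn's lemma for the reversed pointwise order. The pointwise infimum of a chain is subadditive
  because two members of the chain can be replaced by the smaller of the two.
\<close>
lemma minimal_sublinear_below:
  fixes p :: "'v::real_vector \<Rightarrow> real"
  assumes p: "sublinear p"
  shows "\<exists>q. sublinear q \<and> q \<le> p \<and> (\<forall>r. sublinear r \<and> r \<le> q \<longrightarrow> r = q)"
proof -
  let ?A = "{q. sublinear q \<and> q \<le> p}"
  have "\<exists>m\<in>?A. \<forall>a\<in>?A. a \<le> m \<longrightarrow> a = m"
  proof (rule predicate_Zorn[where P = "\<lambda>a b. b \<le> a"])
    show "partial_order_on ?A (relation_of (\<lambda>a b. b \<le> a) ?A)"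
      by (rule partial_order_on_relation_ofI) auto
  next
    fix C assume ch: "C \<in> Chains (relation_of (\<lambda>a b. b \<le> a) ?A)"
    then have sub: "sublinear q" "q \<le> p" if "q \<in> C" for q
      using that by (auto simp: Chains_def relation_of_def)
    have tot: "q \<le> r \<or> r \<le> q" if "q \<in> C" "r \<in> C" for q r
      using ch that by (auto simp: Chains_def relation_of_def)
    show "\<exists>u\<in>?A. \<forall>a\<in>C. u \<le> a"
    proof (cases "C = {}")
      case True
      then show ?thesis using p by auto
    next
      case False
      define u where "u y = (INF q\<in>C. q y)" for y
      have "- p (- y) \<le> q y" if "q \<in> C" for q y
        using sublinear_neg[OF sub(1)[OF that], of y] le_funD[OF sub(2)[OF that], of "- y"] by simp
      then have "bdd_below ((\<lambda>q. q y) ` C)" for y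
        by (intro bdd_belowI2)
      then have u_le: "u y \<le> q y" if "q \<in> C" for q y
        unfolding u_def using that by (intro cINF_lower) auto
      have le_u: "m \<le> u y" if "\<And>q. q \<in> C \<Longrightarrow> m \<le> q y" for m y
        unfolding u_def using False that by (intro cINF_greatest) auto
      have "sublinear u"
        unfolding sublinear_def
      proof (intro conjI allI impI)
        fix y z
        have "u (y + z) \<le> q y + r z" if qr: "q \<in> C" "r \<in> C" for q r
        proof -
          obtain s where "s \<in> C" "s \<le> q" "s \<le> r"
            using tot[OF qr] qr by (metis order_refl)
          then show ?thesis
            using u_le[of s "y + z"] sublinear_add[OF sub(1), of s y z]
              le_funD[of s q y] le_funD[of s r z] by simp
        qed
        then have "u (y + z) - r z \<le> u y" if "r \<in> C" for r
          by (intro le_u) (use that in \<open>fastforce simp: algebra_simps\<close>)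
        then have "u (y + z) - u y \<le> u z"
          by (intro le_u) (fastforce simp: algebra_simps)
        then show "u (y + z) \<le> u y + u z" by simp
      next
        fix c :: real and y assume c: "c > 0"
        have "u (c *\<^sub>R y) / c \<le> q y" if "q \<in> C" for q
          using u_le[OF that, of "c *\<^sub>R y"] c by (simp add: sublinear_scaleR[OF sub(1)[OF that]] field_simps)
        then have "u (c *\<^sub>R y) / c \<le> u y"
          by (rule le_u)
        then show "u (c *\<^sub>R y) \<le> c * u y"
          using c by (simp add: field_simps)
      qed
      moreover have "u \<le> p"
        using False u_le sub(2) by (metis ex_in_conv le_fun_def order_trans)
      ultimately show ?thesis
        using u_le by (auto simp: le_fun_def)
    qed
  qed
  then show ?thesis
    by (metis (no_types, lifting) mem_Collect_eq order_trans)
qed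

text \<open>
  A minimal sublinear functional equals all its tilts, and \<open>p = tilt p z\<close> says that \<open>p\<close> is
  superadditive in the direction \<open>z\<close>.
\<close>
lemma minimal_sublinear_linear:
  assumes p: "sublinear p" and min: "\<And>r. sublinear r \<Longrightarrow> r \<le> p \<Longrightarrow> r = p"
  shows "linear p"
proof -
  have "tilt p z = p" for z
    using tilt_le_self[OF p] by (intro min sublinear_tilt p) (simp add: le_fun_def)
  then have "p y + p z \<le> p (y + z)" for y z
    using tilt_le[OF p, of 1 z y] by simp
  then have add: "p (y + z) = p y + p z" for y z
    using sublinear_add[OF p, of y z] by (simp add: antisym)
  have neg: "p (- y) = - p y" for y
    using add[of y "- y"] sublinear_zero[OF p] by simp
  have "p (c *\<^sub>R y) = c * p y" for c y
  proof -
    consider "c > 0" | "c = 0" | "- c > 0" by linarith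
    then show ?thesis
    proof cases
      case 3
      then show ?thesis
        using sublinear_scaleR[OF p 3, of y] neg by simp
    qed (simp_all add: sublinear_scaleR[OF p] sublinear_zero[OF p])
  qed
  with add show ?thesis
    by (intro linearI) auto
qed

text \<open>
  Starting the search for a minimal functional at the norm tilted along \<open>x\<close>, rather than at the
  norm, forces the value at \<open>x\<close>.
\<close>
lemma supporting_real_functional:
  fixes x :: "'v::real_normed_vector"
  shows "\<exists>g. linear g \<and> (\<forall>y. g y \<le> norm y) \<and> g x = norm x"
proof -
  have n: "sublinear (norm :: 'v \<Rightarrow> real)"
    by (simp add: sublinear_def norm_triangle_ineq)
  obtain g where g: "sublinear g" "g \<le> tilt norm x" "\<And>r. sublinear r \<Longrightarrow> r \<le> g \<Longrightarrow> r = g"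
    using minimal_sublinear_below[OF sublinear_tilt[OF n]] by blast
  have lin: "linear g"
    using g by (intro minimal_sublinear_linear)
  have le: "g y \<le> norm y" for y
    using le_funD[OF g(2), of y] tilt_le_self[OF n, of x y] by simp
  have "g (- x) \<le> - norm x"
    using le_funD[OF g(2), of "- x"] tilt_le[OF n, of 1 x "- x"] by simp
  then have "g x = norm x"
    using le[of x] by (simp add: linear_neg[OF lin])
  with lin le show ?thesis by blast
qed

text \<open>
  The complex Hahn--Banach theorem at a single point. A real functional \<open>g\<close> is the real part of the
  complex-linear functional \<open>y \<mapsto> g y - \<i> g (\<i>y)\<close>, and rotating \<open>y\<close> until the value is real shows that
  the norm does not grow.
\<close>
lemma J_set_nonempty:
  fixes x :: "'a::complex_banach"
  assumes "x \<noteq> 0"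
  shows "J_set x \<noteq> {}"
proof -
  obtain g :: "'a \<Rightarrow> real" where lin: "linear g" and le: "\<And>y. g y \<le> norm y" and gx: "g x = norm x"
    using supporting_real_functional[of x] by blast
  define f where "f y = Complex (g y) (- g (\<i> *\<^sub>C y))" for y
  have fadd: "f (y + z) = f y + f z" for y z
    by (simp add: f_def complex_eq_iff scaleC_add_right linear_add[OF lin])
  have fC: "f (c *\<^sub>C y) = c * f y" for c y
  proof -
    have "c *\<^sub>C y = Re c *\<^sub>R y + Im c *\<^sub>R \<i> *\<^sub>C y"
      by (metis complex_eq mult.commute scaleC_add_left scaleC_of_real scaleC_scaleC)
    moreover have "\<i> *\<^sub>C c *\<^sub>C y = Re c *\<^sub>R \<i> *\<^sub>C y + (- Im c) *\<^sub>R y"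
    proof -
      have "\<i> * c = complex_of_real (Re c) * \<i> + complex_of_real (- Im c)"
        by (simp add: complex_eq_iff)
      then show ?thesis
        by (metis scaleC_add_left scaleC_of_real scaleC_scaleC)
    qed
    ultimately show ?thesis
      by (simp add: f_def complex_eq_iff linear_add[OF lin] linear_diff[OF lin] linear_scale[OF lin] linear_neg[OF lin])
  qed
  have fle: "cmod (f y) \<le> norm y" for y
  proof (cases "f y = 0")
    case False
    define c where "c = cnj (sgn (f y))"
    have c: "cmod c = 1" "c * f y = complex_of_real (cmod (f y))"
      using False complex_norm_square[of "f y"]
      by (simp_all add: c_def norm_sgn sgn_eq field_simps power2_eq_square norm_divide)
    have "cmod (f y) = Re (f (c *\<^sub>C y))"
      by (simp add: fC c)
    also have "\<dots> \<le> norm (c *\<^sub>C y)"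
      using le by (simp add: f_def)
    finally show ?thesis
      by (simp add: norm_scaleC c)
  qed simp
  have "bounded_linear f"
  proof (rule bounded_linear_intro)
    show "f (r *\<^sub>R y) = r *\<^sub>R f y" for r y
      using fC[of "complex_of_real r" y] by (simp add: scaleC_of_real scaleR_conv_of_real)
    show "cmod (f y) \<le> norm y * 1" for y
      using fle by simp
  qed (rule fadd)
  then have ap: "blinfun_apply (Blinfun f) = f"
    by (rule bounded_linear_Blinfun_apply)
  have "Re (f x) = norm x"
    by (simp add: f_def gx)
  moreover have "Im (f x) = 0"
  proof -
    have "(cmod (f x))\<^sup>2 \<le> (norm x)\<^sup>2"
      using fle by (simp add: power_mono)
    then show ?thesis
      using \<open>Re (f x) = norm x\<close> by (simp add: cmod_power2)
  qed
  ultimately have "f x = complex_of_real (norm x)"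
    by (simp add: complex_eq_iff)
  then have "Blinfun f \<in> J_set x"
    using assms by (intro J_setI) (auto simp: ap fC fle dual_def)
  then show ?thesis by blast
qed

section \<open>Disjoint sequences in a face of infinite dimension\<close>

lemma equiv_L1_eq: "equiv {f. integrable M f} (L1_eq M)"
proof (rule equivI)
  show "L1_eq M \<subseteq> {f. integrable M f} \<times> {f. integrable M f}"
    by (auto simp: L1_eq_def)
  show "refl_on {f. integrable M f} (L1_eq M)"
    by (auto simp: L1_eq_def refl_on_def)
  show "sym (L1_eq M)"
    by (auto simp: L1_eq_def sym_def)
  show "trans (L1_eq M)"
    unfolding L1_eq_def trans_def by auto
qed

text \<open>
  The set \<open>A\<close> ranges over all sets, although cuts happen along measurable ones, so that the whole
  type is a possible \<open>A\<close>: for it no representative has to be modified off the underlying space.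
\<close>
definition carried_J ::
    "(('a::complex_banach \<Rightarrow>\<^sub>L complex) \<Rightarrow> ('b \<Rightarrow> complex) set) \<Rightarrow> 'a \<Rightarrow> 'b set \<Rightarrow> ('a \<Rightarrow>\<^sub>L complex) set"
  where "carried_J T x A = {\<phi> \<in> J_set x. \<exists>f\<in>T \<phi>. \<forall>t. t \<notin> A \<longrightarrow> f t = 0}"

definition finite_dim :: "('a::complex_banach \<Rightarrow>\<^sub>L complex) set \<Rightarrow> bool"
  where "finite_dim S \<longleftrightarrow> (\<exists>F. finite F \<and> S \<subseteq> complex_vector.span F)"

lemma finite_dim_span_Un:
  assumes "finite_dim S" "finite_dim S'" "U \<subseteq> complex_vector.span (S \<union> S')"
  shows "finite_dim U"
proof -
  obtain F F' where F: "finite F" "S \<subseteq> complex_vector.span F" "finite F'" "S' \<subseteq> complex_vector.span F'"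
    using assms unfolding finite_dim_def by blast
  have "complex_vector.span F \<subseteq> complex_vector.span (F \<union> F')" "complex_vector.span F' \<subseteq> complex_vector.span (F \<union> F')"
    by (rule complex_vector.span_mono; blast)+
  with F have "S \<union> S' \<subseteq> complex_vector.span (F \<union> F')"
    by blast
  then have "complex_vector.span (S \<union> S') \<subseteq> complex_vector.span (F \<union> F')"
    by (intro complex_vector.span_minimal complex_vector.subspace_span)
  with F assms(3) show ?thesis
    unfolding finite_dim_def by (intro exI[of _ "F \<union> F'"]) auto
qed

text \<open>
  The real parts alone must add up to \<open>r + s\<close>, so neither modulus leaves room for an imaginary part.
\<close>
lemma saturated_triangle:
  fixes a b :: complex
  assumes "cmod a \<le> r" "cmod b \<le> s" "a + b = complex_of_real (r + s)"
  shows "a = complex_of_real r" "b = complex_of_real s"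
proof -
  have key: "c = complex_of_real u" if "cmod c \<le> u" "Re c = u" for c u
  proof -
    have "(cmod c)\<^sup>2 \<le> u\<^sup>2"
      using that by (intro power_mono) auto
    then have "Im c = 0"
      using that by (simp add: cmod_power2)
    with that show ?thesis by (simp add: complex_eq_iff)
  qed
  have "Re a + Re b = r + s"
    using assms(3) by (metis Re_complex_of_real plus_complex.sel(1))
  moreover have "Re a \<le> r" "Re b \<le> s"
    using assms complex_Re_le_cmod order_trans by blast+
  ultimately show "a = complex_of_real r" "b = complex_of_real s"
    using assms by (auto intro!: key)
qed

context
  fixes M :: "'b measure" and T :: "('a::complex_banach \<Rightarrow>\<^sub>L complex) \<Rightarrow> ('b \<Rightarrow> complex) set"
  assumes iso: "dual_L1_isometry M T"
begin

lemma T_in_L1: "\<phi> \<in> dual \<Longrightarrow> T \<phi> \<in> {f. integrable M f} // L1_eq M"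
  using iso bij_betwE unfolding dual_L1_isometry_def L1_def by blast

lemma rep_integrable: "\<phi> \<in> dual \<Longrightarrow> f \<in> T \<phi> \<Longrightarrow> integrable M f"
  using in_quotient_imp_subset[OF equiv_L1_eq T_in_L1] by blast

lemma rep_ex: "\<phi> \<in> dual \<Longrightarrow> \<exists>f. f \<in> T \<phi>"
  using in_quotient_imp_non_empty[OF equiv_L1_eq T_in_L1] by blast

lemma rep_AE:
  assumes "\<phi> \<in> dual" "f \<in> T \<phi>" "integrable M g" "AE t in M. f t = g t"
  shows "g \<in> T \<phi>"
proof -
  have "(f, g) \<in> L1_eq M"
    using assms rep_integrable by (simp add: L1_eq_def)
  then show ?thesis
    using in_quotient_imp_closed[OF equiv_L1_eq T_in_L1] assms by blast
qed

lemma func_ex: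
  assumes "integrable M g"
  shows "\<exists>\<phi>\<in>dual. g \<in> T \<phi>"
proof -
  have "L1_eq M `` {g} \<in> T ` dual"
    using iso assms by (auto simp: dual_L1_isometry_def L1_def bij_betw_def intro!: quotientI)
  moreover have "g \<in> L1_eq M `` {g}"
    using assms by (simp add: L1_eq_def)
  ultimately show ?thesis by auto
qed

lemma rep_inj:
  assumes "\<phi> \<in> dual" "\<psi> \<in> dual" "f \<in> T \<phi>" "f \<in> T \<psi>"
  shows "\<phi> = \<psi>"
proof -
  have "T \<phi> = T \<psi>"
    using quotient_disj[OF equiv_L1_eq T_in_L1 T_in_L1] assms by blast
  then show ?thesis
    using iso assms by (auto simp: dual_L1_isometry_def bij_betw_def inj_on_def)
qed

lemma rep_add: "\<phi> \<in> dual \<Longrightarrow> \<psi> \<in> dual \<Longrightarrow> f \<in> T \<phi> \<Longrightarrow> g \<in> T \<psi> \<Longrightarrow> (\<lambda>t. f t + g t) \<in> T (\<phi> + \<psi>)"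
  using iso unfolding dual_L1_isometry_def by blast

lemma rep_scaleC: "\<phi> \<in> dual \<Longrightarrow> f \<in> T \<phi> \<Longrightarrow> (\<lambda>t. c * f t) \<in> T (c *\<^sub>C \<phi>)"
  using iso unfolding dual_L1_isometry_def by blast

lemma rep_scaleR: "\<phi> \<in> dual \<Longrightarrow> f \<in> T \<phi> \<Longrightarrow> (\<lambda>t. r *\<^sub>R f t) \<in> T (r *\<^sub>R \<phi>)"
  using rep_scaleC[of \<phi> f "complex_of_real r"] by (simp add: scaleC_of_real scaleR_conv_of_real)

lemma rep_diff:
  assumes "\<phi> \<in> dual" "\<psi> \<in> dual" "f \<in> T \<phi>" "g \<in> T \<psi>"
  shows "(\<lambda>t. f t - g t) \<in> T (\<phi> - \<psi>)"
  using rep_add[OF assms(1) dual_scaleR[OF assms(2)] assms(3) rep_scaleR[OF assms(2,4)], of "-1"] by simp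

lemma rep_norm: "\<phi> \<in> dual \<Longrightarrow> f \<in> T \<phi> \<Longrightarrow> (\<integral>t. cmod (f t) \<partial>M) = norm \<phi>"
  using iso unfolding dual_L1_isometry_def by blast

lemma rep_of_zero:
  assumes "(0 :: 'a \<Rightarrow>\<^sub>L complex) \<in> dual" "f \<in> T 0"
  shows "AE t in M. f t = 0"
proof -
  have "integrable M (\<lambda>t. cmod (f t))" "(\<integral>t. cmod (f t) \<partial>M) = 0"
    using rep_norm[OF assms] rep_integrable[OF assms] by auto
  then show ?thesis
    using integral_nonneg_eq_0_iff_AE[of M "\<lambda>t. cmod (f t)"] by simp
qed

text \<open>
  The face property in \<open>L\<^sup>1\<close>. The norms of the two pieces add up to \<open>norm \<phi>\<close>, so \<open>\<phi>\<close> can only attain its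
  norm at \<open>x\<close> if both pieces do.
\<close>
lemma J_cut:
  assumes J: "\<phi> \<in> J_set x" and f: "f \<in> T \<phi>" and A: "A \<in> sets M"
  obtains \<phi>\<^sub>1 \<phi>\<^sub>2 where "\<phi>\<^sub>1 \<in> dual" "\<phi>\<^sub>2 \<in> dual" "\<phi> = \<phi>\<^sub>1 + \<phi>\<^sub>2"
    "(\<lambda>t. indicator A t *\<^sub>R f t) \<in> T \<phi>\<^sub>1" "(\<lambda>t. f t - indicator A t *\<^sub>R f t) \<in> T \<phi>\<^sub>2"
    "blinfun_apply \<phi>\<^sub>1 x = complex_of_real (norm \<phi>\<^sub>1 * norm x)"
    "blinfun_apply \<phi>\<^sub>2 x = complex_of_real (norm \<phi>\<^sub>2 * norm x)"
proof -
  let ?f1 = "\<lambda>t. indicator A t *\<^sub>R f t" and ?f2 = "\<lambda>t. f t - indicator A t *\<^sub>R f t"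
  have d: "\<phi> \<in> dual" using J by (simp add: J_set_def)
  have int: "integrable M f" "integrable M ?f1" "integrable M ?f2"
    using rep_integrable[OF d f] A by (auto intro: integrable_mult_indicator)
  then obtain \<phi>\<^sub>1 where 1: "\<phi>\<^sub>1 \<in> dual" "?f1 \<in> T \<phi>\<^sub>1"
    using func_ex by blast
  define \<phi>\<^sub>2 where "\<phi>\<^sub>2 = \<phi> - \<phi>\<^sub>1"
  have 2: "\<phi>\<^sub>2 \<in> dual" "?f2 \<in> T \<phi>\<^sub>2"
    using rep_diff[OF d 1(1) f 1(2)] dual_add[OF d dual_scaleR[OF 1(1), of "-1"]]
    by (simp_all add: \<phi>\<^sub>2_def)
  have "(\<integral>t. cmod (f t) \<partial>M) = (\<integral>t. cmod (?f1 t) + cmod (?f2 t) \<partial>M)"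
    by (intro Bochner_Integration.integral_cong) (auto simp: indicator_def)
  also have "\<dots> = (\<integral>t. cmod (?f1 t) \<partial>M) + (\<integral>t. cmod (?f2 t) \<partial>M)"
    using int by (intro Bochner_Integration.integral_add integrable_norm)
  finally have norms: "norm \<phi>\<^sub>1 + norm \<phi>\<^sub>2 = 1"
    using rep_norm[OF d f] rep_norm[OF 1] rep_norm[OF 2] J by (simp add: J_set_def)
  have "blinfun_apply \<phi>\<^sub>1 x + blinfun_apply \<phi>\<^sub>2 x
      = complex_of_real (norm \<phi>\<^sub>1 * norm x + norm \<phi>\<^sub>2 * norm x)"
    using J norms by (simp add: \<phi>\<^sub>2_def blinfun.diff_left J_set_def flip: distrib_right)
  from saturated_triangle[OF norm_blinfun norm_blinfun this] show thesis
    using 1 2 by (intro that[of \<phi>\<^sub>1 \<phi>\<^sub>2]) (auto simp: \<phi>\<^sub>2_def)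
qed

lemma normalize_carried:
  assumes "\<phi> \<in> dual" "f \<in> T \<phi>" "\<And>t. t \<notin> A \<Longrightarrow> f t = 0"
    and "blinfun_apply \<phi> x = complex_of_real (norm \<phi> * norm x)" "\<phi> \<noteq> 0"
  shows "inverse (norm \<phi>) *\<^sub>R \<phi> \<in> carried_J T x A"
proof -
  have "(\<lambda>t. inverse (norm \<phi>) *\<^sub>R f t) \<in> T (inverse (norm \<phi>) *\<^sub>R \<phi>)"
    by (rule rep_scaleR[OF assms(1,2)])
  moreover have "inverse (norm \<phi>) *\<^sub>R \<phi> \<in> J_set x"
    using assms by (simp add: J_set_def dual_scaleR blinfun.scaleR_left scaleR_conv_of_real)
  moreover have "\<forall>t. t \<notin> A \<longrightarrow> inverse (norm \<phi>) *\<^sub>R f t = 0"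
    using assms(3) by simp
  ultimately show ?thesis
    unfolding carried_J_def by (intro CollectI conjI bexI)
qed

lemma carried_J_span:
  assumes A: "A \<in> sets M"
  shows "carried_J T x B \<subseteq> complex_vector.span (carried_J T x (B \<inter> A) \<union> carried_J T x (B - A))"
    (is "_ \<subseteq> complex_vector.span ?S")
proof
  fix \<phi> assume "\<phi> \<in> carried_J T x B"
  then obtain f where J: "\<phi> \<in> J_set x" and f: "f \<in> T \<phi>" and f0: "\<And>t. t \<notin> B \<Longrightarrow> f t = 0"
    unfolding carried_J_def by blast
  obtain \<phi>\<^sub>1 \<phi>\<^sub>2 where c: "\<phi>\<^sub>1 \<in> dual" "\<phi>\<^sub>2 \<in> dual" "\<phi> = \<phi>\<^sub>1 + \<phi>\<^sub>2"
    "(\<lambda>t. indicator A t *\<^sub>R f t) \<in> T \<phi>\<^sub>1" "(\<lambda>t. f t - indicator A t *\<^sub>R f t) \<in> T \<phi>\<^sub>2"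
    "blinfun_apply \<phi>\<^sub>1 x = complex_of_real (norm \<phi>\<^sub>1 * norm x)"
    "blinfun_apply \<phi>\<^sub>2 x = complex_of_real (norm \<phi>\<^sub>2 * norm x)"
    by (rule J_cut[OF J f A])
  have sp: "\<psi> \<in> complex_vector.span ?S" if "\<psi> \<noteq> 0 \<Longrightarrow> inverse (norm \<psi>) *\<^sub>R \<psi> \<in> ?S" for \<psi>
  proof (cases "\<psi> = 0")
    case False
    then have "complex_of_real (norm \<psi>) *\<^sub>C inverse (norm \<psi>) *\<^sub>R \<psi> \<in> complex_vector.span ?S"
      by (intro complex_vector.span_scale complex_vector.span_base that)
    with False show ?thesis
      by (simp add: scaleC_of_real)
  qed (simp add: complex_vector.span_zero)
  have "\<phi>\<^sub>1 \<in> complex_vector.span ?S"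
    by (rule sp, rule UnI1, rule normalize_carried[OF c(1,4) _ c(6)]) (auto simp: f0 indicator_def)
  moreover have "\<phi>\<^sub>2 \<in> complex_vector.span ?S"
    by (rule sp, rule UnI2, rule normalize_carried[OF c(2,5) _ c(7)]) (auto simp: f0 indicator_def)
  ultimately show "\<phi> \<in> complex_vector.span ?S"
    unfolding c(3) by (rule complex_vector.span_add)
qed

text \<open>
  As the midpoint of \<open>\<phi>\<close> and \<open>\<psi>\<close> has norm 1 as well, their representatives \<open>f\<close> and \<open>g\<close> have the
  same phase, so \<open>f \<noteq> g\<close> forces \<open>\<bar>f\<bar> \<noteq> \<bar>g\<bar>\<close> on a set of positive measure. Since \<open>\<bar>f\<bar>\<close> and
  \<open>\<bar>g\<bar>\<close> have equal integrals, each of them exceeds the other on a set of positive measure. The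
  cut along \<open>\<bar>g\<bar> < \<bar>f\<bar>\<close> leaves something of \<open>f\<close> inside and something of \<open>g\<close> outside.
\<close>
lemma carried_J_split:
  assumes "x \<noteq> 0" and in_B: "\<phi> \<in> carried_J T x B" "\<psi> \<in> carried_J T x B" and ne: "\<phi> \<noteq> \<psi>"
  obtains A where "A \<in> sets M" "carried_J T x (B \<inter> A) \<noteq> {}" "carried_J T x (B - A) \<noteq> {}"
proof -
  obtain f where J: "\<phi> \<in> J_set x" and f: "f \<in> T \<phi>" and f0: "\<And>t. t \<notin> B \<Longrightarrow> f t = 0"
    using in_B(1) unfolding carried_J_def by blast
  obtain g where J': "\<psi> \<in> J_set x" and g: "g \<in> T \<psi>" and g0: "\<And>t. t \<notin> B \<Longrightarrow> g t = 0"
    using in_B(2) unfolding carried_J_def by blast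
  have d: "\<phi> \<in> dual" "\<psi> \<in> dual"
    using J J' by (auto simp: J_set_def)
  note int = rep_integrable[OF d(1) f] rep_integrable[OF d(2) g]
  have [measurable]: "f \<in> borel_measurable M" "g \<in> borel_measurable M"
    using int by auto
  have nf: "(\<integral>t. cmod (f t) \<partial>M) = 1" and ng: "(\<integral>t. cmod (g t) \<partial>M) = 1"
    using rep_norm[OF d(1) f] rep_norm[OF d(2) g] J J' by (simp_all add: J_set_def)
  have "(1/2) *\<^sub>R \<phi> + (1/2) *\<^sub>R \<psi> \<in> J_set x"
    by (rule convexD[OF convex_J_set[OF \<open>x \<noteq> 0\<close>] J J']) auto
  then have "norm ((1/2) *\<^sub>R (\<phi> + \<psi>)) = 1"
    by (simp add: J_set_def scaleR_add_right)
  then have "(\<integral>t. cmod (f t + g t) \<partial>M) = 2"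
    using rep_norm[OF dual_add[OF d] rep_add[OF d f g]] by simp
  then have "(\<integral>t. cmod (f t) + cmod (g t) - cmod (f t + g t) \<partial>M) = 0"
    using int nf ng by simp
  then have same_phase: "AE t in M. cmod (f t + g t) = cmod (f t) + cmod (g t)"
    using int norm_triangle_ineq
    by (subst (asm) integral_nonneg_eq_0_iff_AE) (auto elim!: eventually_mono)
  have eqI: "AE t in M. f t = g t" if "AE t in M. cmod (f t) = cmod (g t)"
    using that same_phase
  proof eventually_elim
    case (elim t)
    then have "cmod (f t) *\<^sub>R g t = cmod (f t) *\<^sub>R f t"
      using norm_triangle_eq[of "f t" "g t"] by (simp del: scaleR_cancel_left)
    with elim show ?case
      by (cases "f t = 0") auto
  qed
  have not_eq: "\<not> (AE t in M. f t = g t)"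
    using rep_AE[OF d(1) f int(2)] rep_inj[OF d] g ne by blast
  define A where "A = {t \<in> space M. cmod (g t) < cmod (f t)}"
  have A: "A \<in> sets M"
    unfolding A_def by measurable
  have "carried_J T x (B \<inter> A) \<noteq> {}"
  proof
    assume empty: "carried_J T x (B \<inter> A) = {}"
    obtain \<phi>\<^sub>1 \<phi>\<^sub>2 where cut: "\<phi>\<^sub>1 \<in> dual" "\<phi>\<^sub>2 \<in> dual" "\<phi> = \<phi>\<^sub>1 + \<phi>\<^sub>2"
      "(\<lambda>t. indicator A t *\<^sub>R f t) \<in> T \<phi>\<^sub>1" "(\<lambda>t. f t - indicator A t *\<^sub>R f t) \<in> T \<phi>\<^sub>2"
      "blinfun_apply \<phi>\<^sub>1 x = complex_of_real (norm \<phi>\<^sub>1 * norm x)"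
      "blinfun_apply \<phi>\<^sub>2 x = complex_of_real (norm \<phi>\<^sub>2 * norm x)"
      by (rule J_cut[OF J f A])
    note c = cut(1,4,6)
    have "\<phi>\<^sub>1 = 0"
      using normalize_carried[OF c(1,2) _ c(3), of "B \<inter> A"] f0 empty by (auto simp: indicator_def)
    then have "AE t in M. indicator A t *\<^sub>R f t = 0"
      using rep_of_zero c by blast
    then have "AE t in M. 0 \<le> cmod (g t) - cmod (f t)"
      by (rule AE_mp) (auto simp: A_def indicator_def intro!: AE_I2)
    moreover have "(\<integral>t. cmod (g t) - cmod (f t) \<partial>M) = 0"
      using int nf ng by simp
    ultimately have "AE t in M. cmod (g t) - cmod (f t) = 0"
      using int by (subst (asm) integral_nonneg_eq_0_iff_AE) auto
    then have "AE t in M. cmod (f t) = cmod (g t)"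
      by (auto elim!: eventually_mono)
    then show False
      using eqI not_eq by blast
  qed
  moreover have "carried_J T x (B - A) \<noteq> {}"
  proof
    assume empty: "carried_J T x (B - A) = {}"
    obtain \<psi>\<^sub>1 \<psi>\<^sub>2 where cut: "\<psi>\<^sub>1 \<in> dual" "\<psi>\<^sub>2 \<in> dual" "\<psi> = \<psi>\<^sub>1 + \<psi>\<^sub>2"
      "(\<lambda>t. indicator A t *\<^sub>R g t) \<in> T \<psi>\<^sub>1" "(\<lambda>t. g t - indicator A t *\<^sub>R g t) \<in> T \<psi>\<^sub>2"
      "blinfun_apply \<psi>\<^sub>1 x = complex_of_real (norm \<psi>\<^sub>1 * norm x)"
      "blinfun_apply \<psi>\<^sub>2 x = complex_of_real (norm \<psi>\<^sub>2 * norm x)"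
      by (rule J_cut[OF J' g A])
    note c = cut(2,5,7)
    have "g t - indicator A t *\<^sub>R g t = 0" if "t \<notin> B - A" for t
      using that g0[of t] by (cases "t \<in> A") auto
    then have "\<psi>\<^sub>2 = 0"
      using normalize_carried[OF c(1,2) _ c(3), of "B - A"] empty by blast
    then have "AE t in M. g t - indicator A t *\<^sub>R g t = 0"
      using rep_of_zero c by blast
    then have "AE t in M. 0 \<le> cmod (f t) - cmod (g t)"
      by (rule AE_mp) (auto simp: A_def indicator_def split: if_splits intro!: AE_I2)
    moreover have "(\<integral>t. cmod (f t) - cmod (g t) \<partial>M) = 0"
      using int nf ng by simp
    ultimately have "AE t in M. cmod (f t) - cmod (g t) = 0"
      using int by (subst (asm) integral_nonneg_eq_0_iff_AE) auto
    then have "AE t in M. cmod (f t) = cmod (g t)"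
      by (auto elim!: eventually_mono)
    then show False
      using eqI not_eq by blast
  qed
  ultimately show thesis
    using that A by blast
qed

lemma norm_diff_carried_J:
  assumes p: "p \<in> carried_J T x A" and q: "q \<in> carried_J T x B" and "A \<inter> B = {}"
  shows "norm (p - q) = 2"
proof -
  obtain f where J: "p \<in> J_set x" and f: "f \<in> T p" and f0: "\<And>t. t \<notin> A \<Longrightarrow> f t = 0"
    using p unfolding carried_J_def by blast
  obtain g where J': "q \<in> J_set x" and g: "g \<in> T q" and g0: "\<And>t. t \<notin> B \<Longrightarrow> g t = 0"
    using q unfolding carried_J_def by blast
  have d: "p \<in> dual" "q \<in> dual"
    using J J' by (auto simp: J_set_def)
  have "cmod (f t - g t) = cmod (f t) + cmod (g t)" for t
  proof (cases "t \<in> A")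
    case True
    then have "g t = 0" using g0 assms(3) by blast
    then show ?thesis by simp
  qed (simp add: f0)
  then have "(\<integral>t. cmod (f t - g t) \<partial>M) = (\<integral>t. cmod (f t) \<partial>M) + (\<integral>t. cmod (g t) \<partial>M)"
    using rep_integrable[OF d(1) f] rep_integrable[OF d(2) g] by simp
  moreover have "p - q \<in> dual"
    using dual_add[OF d(1) dual_scaleR[OF d(2), of "-1"]] by simp
  ultimately show ?thesis
    using rep_norm[OF d(1) f] rep_norm[OF d(2) g] rep_norm[OF _ rep_diff[OF d f g]] J J'
    by (simp add: J_set_def)
qed

lemma convex_carried_J:
  assumes "x \<noteq> 0"
  shows "convex (carried_J T x A)"
proof (rule convexI)
  fix p q and u v :: real
  assume p: "p \<in> carried_J T x A" and q: "q \<in> carried_J T x A" and uv: "0 \<le> u" "0 \<le> v" "u + v = 1"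
  obtain f where J: "p \<in> J_set x" and f: "f \<in> T p" and f0: "\<And>t. t \<notin> A \<Longrightarrow> f t = 0"
    using p unfolding carried_J_def by blast
  obtain g where J': "q \<in> J_set x" and g: "g \<in> T q" and g0: "\<And>t. t \<notin> A \<Longrightarrow> g t = 0"
    using q unfolding carried_J_def by blast
  have d: "p \<in> dual" "q \<in> dual"
    using J J' by (auto simp: J_set_def)
  have "(\<lambda>t. u *\<^sub>R f t + v *\<^sub>R g t) \<in> T (u *\<^sub>R p + v *\<^sub>R q)"
    by (intro rep_add rep_scaleR dual_scaleR d f g)
  moreover have "u *\<^sub>R p + v *\<^sub>R q \<in> J_set x"
    by (rule convexD[OF convex_J_set[OF assms] J J' uv])
  moreover have "\<forall>t. t \<notin> A \<longrightarrow> u *\<^sub>R f t + v *\<^sub>R g t = 0"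
    using f0 g0 by simp
  ultimately show "u *\<^sub>R p + v *\<^sub>R q \<in> carried_J T x A"
    unfolding carried_J_def by (intro CollectI conjI bexI)
qed

text \<open>
  After each cut one of the two sides still spans an infinite-dimensional space. The construction
  continues there and takes the next \<open>f i\<close> from the other side.
\<close>
lemma disjoint_sequence_in_J:
  fixes x :: 'a
  assumes x: "x \<noteq> 0" and inf: "\<not> finite_dim (J_set x)"
  obtains f :: "nat \<Rightarrow> 'a \<Rightarrow>\<^sub>L complex" where "\<And>i. f i \<in> J_set x"
    "\<And>m p q. p \<in> convex hull (f ` {..<m}) \<Longrightarrow> q \<in> convex hull (f ` {m..}) \<Longrightarrow> norm (p - q) = 2"
proof -
  have "\<exists>B. \<forall>n. \<not> finite_dim (carried_J T x (B n)) \<and> (B (Suc n) \<subseteq> B n \<and> carried_J T x (B n - B (Suc n)) \<noteq> {})"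
  proof (rule dependent_nat_choice)
    have "carried_J T x UNIV = J_set x"
      using rep_ex by (auto simp: carried_J_def J_set_def)
    with inf show "\<exists>B. \<not> finite_dim (carried_J T x B)"
      by metis
  next
    fix B assume B: "\<not> finite_dim (carried_J T x B)"
    have "\<not> carried_J T x B \<subseteq> {\<phi>}" for \<phi>
      using B complex_vector.span_superset[of "{\<phi>}"] unfolding finite_dim_def
      by (metis finite.emptyI finite.insertI order_trans)
    then obtain \<phi> \<psi> where "\<phi> \<in> carried_J T x B" "\<psi> \<in> carried_J T x B" "\<phi> \<noteq> \<psi>"
      by (metis insertI1 subsetI)
    then obtain A where A: "A \<in> sets M" "carried_J T x (B \<inter> A) \<noteq> {}" "carried_J T x (B - A) \<noteq> {}"
      by (rule carried_J_split[OF x])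
    consider "\<not> finite_dim (carried_J T x (B \<inter> A))" | "\<not> finite_dim (carried_J T x (B - A))"
      using B finite_dim_span_Un[OF _ _ carried_J_span[OF A(1)]] by blast
    then show "\<exists>B'. \<not> finite_dim (carried_J T x B') \<and> (B' \<subseteq> B \<and> carried_J T x (B - B') \<noteq> {})"
    proof cases
      case 1
      then show ?thesis
        using A(3) by (intro exI[of _ "B \<inter> A"]) (auto simp: Diff_Int)
    next
      case 2
      then show ?thesis
        using A(2) by (intro exI[of _ "B - A"]) (auto simp: Diff_Diff_Int)
    qed
  qed
  then obtain B where dec: "\<And>n. B (Suc n) \<subseteq> B n" and ne: "\<And>n. carried_J T x (B n - B (Suc n)) \<noteq> {}"
    by blast
  define f where "f n = (SOME \<phi>. \<phi> \<in> carried_J T x (B n - B (Suc n)))" for n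
  have f: "f n \<in> carried_J T x (B n - B (Suc n))" for n
    unfolding f_def using ne[of n] by (simp add: some_in_eq)
  have anti: "B n \<subseteq> B m" if "m \<le> n" for m n
    using lift_Suc_antimono_le[of B, OF dec that] .
  have mono: "carried_J T x C \<subseteq> carried_J T x C'" if "C \<subseteq> C'" for C C'
    using that unfolding carried_J_def by blast
  show thesis
  proof (rule that)
    show "f i \<in> J_set x" for i
      using f[of i] by (simp add: carried_J_def)
    fix m p q
    assume p: "p \<in> convex hull (f ` {..<m})" and q: "q \<in> convex hull (f ` {m..})"
    have "f ` {..<m} \<subseteq> carried_J T x (- B m)"
    proof (rule image_subsetI)
      fix i assume "i \<in> {..<m}"
      then have "B i - B (Suc i) \<subseteq> - B m"
        using anti[of "Suc i" m] by auto
      from mono[OF this] f[of i] show "f i \<in> carried_J T x (- B m)" by blast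
    qed
    with p have "p \<in> carried_J T x (- B m)"
      using hull_minimal[of _ _ convex, OF _ convex_carried_J[OF x]] by blast
    moreover have "f ` {m..} \<subseteq> carried_J T x (B m)"
    proof (rule image_subsetI)
      fix i assume "i \<in> {m..}"
      then have "B i - B (Suc i) \<subseteq> B m"
        using anti[of m i] by auto
      from mono[OF this] f[of i] show "f i \<in> carried_J T x (B m)" by blast
    qed
    with q have "q \<in> carried_J T x (B m)"
      using hull_minimal[of _ _ convex, OF _ convex_carried_J[OF x]] by blast
    ultimately show "norm (p - q) = 2"
      by (rule norm_diff_carried_J) auto
  qed
qed

end

section \<open>Weak* convergence in the face\<close>

text \<open>
  The Banach--Alaoglu theorem for the face, applied to countably or uncountably many sequences at
  once: values of functionals are points of a product of compact discs. A cluster point is turned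
  into a limit along a filter finer than \<open>sequentially\<close>, so that all limits are taken along
  the same filter and the usual limit rules apply.
\<close>
lemma J_set_weak_star_compact:
  fixes G :: "nat \<Rightarrow> 'i \<Rightarrow> ('a::complex_banach \<Rightarrow>\<^sub>L complex)"
  assumes x: "x \<noteq> 0" and G: "\<And>K i. G K i \<in> J_set x"
  obtains F L where "F \<le> sequentially" "F \<noteq> bot" "\<And>i. L i \<in> J_set x"
    "\<And>i y. ((\<lambda>K. blinfun_apply (G K i) y) \<longlongrightarrow> blinfun_apply (L i) y) F"
proof -
  define g where "g K = (\<lambda>(i, y). blinfun_apply (G K i) y)" for K
  define C where "C = (\<Pi>\<^sub>E j\<in>UNIV. cball (0::complex) (norm (snd (j :: 'i \<times> 'a))))"
  have "compact C"
    unfolding C_def compactin_euclidean_iff[symmetric] euclidean_product_topology[symmetric]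
    by (subst compactin_PiE) (simp del: euclidean_product_topology)
  moreover have "g K \<in> C" for K
    using J_set_bound[OF G] by (auto simp: g_def C_def)
  then have "eventually (\<lambda>z. z \<in> C) (filtermap g sequentially)"
    by (simp add: eventually_filtermap)
  ultimately obtain H where H: "H \<in> C" and ninf: "inf (nhds H) (filtermap g sequentially) \<noteq> bot"
    unfolding compact_filter by (metis filtermap_bot_iff sequentially_bot)
  define F where "F = inf (filtercomap g (nhds H)) sequentially"
  have "F \<noteq> bot"
  proof
    assume "F = bot"
    then have "eventually (\<lambda>_. False) F" by simp
    then obtain P Q where PQ: "eventually P (filtercomap g (nhds H))" "eventually Q sequentially" "\<And>K. P K \<Longrightarrow> Q K \<Longrightarrow> False"
      unfolding F_def eventually_inf by blast
    obtain P' where P': "eventually P' (nhds H)" "\<And>K. P' (g K) \<Longrightarrow> P K"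
      using PQ(1) unfolding eventually_filtercomap by blast
    have "eventually (\<lambda>z. \<exists>K. g K = z \<and> Q K) (filtermap g sequentially)"
      unfolding eventually_filtermap using PQ(2) by eventually_elim blast
    with P'(1) have "eventually (\<lambda>_. False) (inf (nhds H) (filtermap g sequentially))"
      unfolding eventually_inf using P'(2) PQ(3) by blast
    with ninf show False
      by (simp add: eventually_False)
  qed
  have "F \<le> sequentially" "F \<le> filtercomap g (nhds H)"
    by (simp_all add: F_def)
  have "(g \<longlongrightarrow> H) F"
    by (rule filterlim_mono[OF filterlim_filtercomap order_refl \<open>F \<le> filtercomap g (nhds H)\<close>])
  then have "((\<lambda>K. g K j) \<longlongrightarrow> H j) F" for j
    by (rule continuous_on_tendsto_compose[OF continuous_on_product_coordinates]) auto
  then have lim: "((\<lambda>K. blinfun_apply (G K i) y) \<longlongrightarrow> H (i, y)) F" for i y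
    by (force simp: g_def)
  have Hb: "cmod (H (i, y)) \<le> norm y" for i y
    using H by (auto simp: C_def PiE_def Pi_def)
  have Hadd: "H (i, y + z) = H (i, y) + H (i, z)" for i y z
    using tendsto_unique[OF \<open>F \<noteq> bot\<close> lim[of i "y + z"]] tendsto_add[OF lim[of i y] lim[of i z]]
    by (simp add: blinfun.add_right)
  have HC: "H (i, c *\<^sub>C y) = c * H (i, y)" for i c y
    using tendsto_unique[OF \<open>F \<noteq> bot\<close> lim[of i "c *\<^sub>C y"]] tendsto_mult_left[OF lim[of i y], of c] G
    by (simp add: J_set_def dual_scaleC_apply)
  have Hx: "H (i, x) = complex_of_real (norm x)" for i
    using tendsto_unique[OF \<open>F \<noteq> bot\<close> lim[of i x]] G by (simp add: J_set_def)
  define L where "L i = Blinfun (\<lambda>y. H (i, y))" for i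
  have "bounded_linear (\<lambda>y. H (i, y))" for i
  proof (rule bounded_linear_intro)
    show "H (i, r *\<^sub>R y) = r *\<^sub>R H (i, y)" for r y
      using HC[of i "complex_of_real r" y] by (simp add: scaleC_of_real scaleR_conv_of_real)
    show "cmod (H (i, y)) \<le> norm y * 1" for y
      using Hb by simp
  qed (rule Hadd)
  then have L: "blinfun_apply (L i) = (\<lambda>y. H (i, y))" for i
    unfolding L_def by (rule bounded_linear_Blinfun_apply)
  have "L i \<in> J_set x" for i
    using x by (intro J_setI) (auto simp: L Hb HC Hx dual_def)
  then show thesis
    using that[OF \<open>F \<le> sequentially\<close> \<open>F \<noteq> bot\<close>, of L] lim by (simp add: L)
qed

text \<open>
  If \<open>h\<close> does not converge in norm, a subsequence keeps a distance \<open>\<eta>\<close> from \<open>g\<close>. As the norm is weak*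
  lower semicontinuous, the terms far out keep a distance \<open>\<eta>/2\<close> from any given term of it, so a
  further subsequence is separated and \<open>(\<ddagger>)\<close> contradicts \<open>norm g = 1\<close>.
\<close>
lemma ddagger_weak_star_imp_norm:
  fixes h :: "nat \<Rightarrow> 'a::complex_banach \<Rightarrow>\<^sub>L complex"
  assumes dd: "property_ddagger TYPE('a)" and x: "norm x = 1"
    and h: "\<And>k. h k \<in> J_set x" and g: "g \<in> J_set x"
    and lim: "\<And>y. (\<lambda>k. blinfun_apply (h k) y) \<longlonglongrightarrow> blinfun_apply g y"
  shows "h \<longlonglongrightarrow> g"
proof (rule ccontr)
  assume "\<not> h \<longlonglongrightarrow> g"
  then obtain \<eta> where \<eta>: "\<eta> > 0" and inf: "\<And>N. \<exists>k\<ge>N. \<eta> \<le> norm (h k - g)"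
    unfolding LIMSEQ_iff by (meson not_le)
  define S where "S = {k. \<eta> \<le> norm (h k - g)}"
  have far: "\<exists>N. \<forall>k\<ge>N. \<eta> / 2 \<le> norm (h k - h l)" if l: "l \<in> S" for l
  proof -
    have "\<exists>y. \<eta> / 2 * norm y < cmod (blinfun_apply (h l - g) y)"
    proof (rule ccontr)
      assume "\<nexists>y. \<eta> / 2 * norm y < cmod (blinfun_apply (h l - g) y)"
      then have "norm (h l - g) \<le> \<eta> / 2"
        using \<eta> by (intro norm_blinfun_bound) (auto simp: not_less)
      with l \<eta> show False by (simp add: S_def)
    qed
    then obtain y where y: "\<eta> / 2 * norm y < cmod (blinfun_apply (h l - g) y)" ..
    have "(\<lambda>k. cmod (blinfun_apply (h l - h k) y)) \<longlonglongrightarrow> cmod (blinfun_apply (h l - g) y)"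
      unfolding blinfun.diff_left by (intro tendsto_intros lim)
    from order_tendstoD(1)[OF this y] obtain N where
      N: "\<And>k. k \<ge> N \<Longrightarrow> \<eta> / 2 * norm y < cmod (blinfun_apply (h l - h k) y)"
      unfolding eventually_sequentially by blast
    have "\<eta> / 2 \<le> norm (h k - h l)" if "k \<ge> N" for k
    proof (rule ccontr)
      assume "\<not> ?thesis"
      then have "norm (h l - h k) * norm y \<le> \<eta> / 2 * norm y"
        by (intro mult_right_mono) (auto simp: norm_minus_commute)
      with N[OF that] norm_blinfun[of "h l - h k" y] show False by simp
    qed
    then show ?thesis by blast
  qed
  then obtain N where N: "\<And>l k. l \<in> S \<Longrightarrow> N l \<le> k \<Longrightarrow> \<eta> / 2 \<le> norm (h k - h l)"
    by metis
  have "\<exists>\<rho>. \<forall>n::nat. \<rho> n \<in> S \<and> max (Suc (\<rho> n)) (N (\<rho> n)) \<le> \<rho> (Suc n)"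
  proof (rule dependent_nat_choice)
    show "\<exists>k. k \<in> S"
      using inf unfolding S_def by blast
    show "\<exists>k. k \<in> S \<and> max (Suc l) (N l) \<le> k" for l
      using inf[of "max (Suc l) (N l)"] unfolding S_def by blast
  qed
  then obtain \<rho> where \<rho>: "\<And>n. \<rho> n \<in> S" "\<And>n. Suc (\<rho> n) \<le> \<rho> (Suc n)" "\<And>n. N (\<rho> n) \<le> \<rho> (Suc n)"
    by auto
  have sm: "strict_mono \<rho>"
    using \<rho>(2) by (auto simp: strict_mono_Suc_iff Suc_le_eq)
  have sep1: "\<eta> / 2 \<le> norm (h (\<rho> m) - h (\<rho> n))" if "n < m" for m n
    using \<rho>(3)[of n] strict_mono_less_eq[OF sm, of "Suc n" m] that
    by (intro N \<rho>(1)) auto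
  have sep: "\<eta> / 2 \<le> norm (h (\<rho> m) - h (\<rho> n))" if "m \<noteq> n" for m n
    using sep1[of n m] sep1[of m n] that by (cases "n < m") (auto simp: norm_minus_commute)
  (* Property (\<ddagger>) only speaks about separation constants below 2. *)
  define \<epsilon> where "\<epsilon> = min (\<eta> / 2) 1"
  have \<epsilon>: "0 < \<epsilon>" "\<epsilon> < 2"
    using \<eta> by (auto simp: \<epsilon>_def)
  let ?r = "{(m, n). m \<le> (n::nat)}"
  have dir: "directed_set UNIV ?r"
    unfolding directed_set_def preorder_on_def
    by (auto simp: refl_on_def trans_def intro: max.cobounded1 max.cobounded2)
  have ng: "\<not> has_greatest UNIV ?r"
    unfolding has_greatest_def by (auto intro: exI[of _ "Suc _"] simp: not_le)
  have tails: "tails UNIV ?r = sequentially"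
    by (rule filter_eqI) (simp add: eventually_tails[OF dir] eventually_sequentially)
  have attain: "norm_attaining \<phi>" if "\<phi> \<in> J_set x" for \<phi>
    using that x unfolding norm_attaining_def J_set_def by (intro bexI[of _ x]) auto
  have "limitin weak_star_topology (\<lambda>n. h (\<rho> n)) g sequentially"
  proof (subst limitin_weak_star)
    show "\<forall>y. (\<lambda>n. blinfun_apply (h (\<rho> n)) y) \<longlonglongrightarrow> blinfun_apply g y"
      using LIMSEQ_subseq_LIMSEQ[OF lim sm] by (simp add: o_def)
  qed (use g h in \<open>auto simp: J_set_def\<close>)
  then have "norm g \<le> 1 - \<epsilon> / 2"
    using property_ddagger_any_index[OF dd, where 'i = nat, unfolded ddagger_nets_def,
        THEN spec[where x = \<epsilon>], THEN mp[OF _ conjI[OF \<epsilon>]], THEN spec[where x = UNIV],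
        THEN spec[where x = "?r"], THEN spec[where x = "\<lambda>n. h (\<rho> n)"], THEN spec[where x = g]]
      dir ng sep h g attain
    by (simp add: tails J_set_def \<epsilon>_def min_le_iff_disj)
  with g \<epsilon> show False
    by (simp add: J_set_def)
qed

section \<open>Sequences of convex combinations\<close>

text \<open>
  A generalized subsequence: discarding terms and averaging later terms are both allowed. Unlike
  the subsequence relation, this one is preserved by averaging two sequences.
\<close>
definition tail_convex :: "(nat \<Rightarrow> 'v::real_vector) \<Rightarrow> (nat \<Rightarrow> 'v) \<Rightarrow> bool"
  where "tail_convex b a \<longleftrightarrow> (\<forall>n. b n \<in> convex hull (a ` {n..}))"

lemma tail_convex_refl: "tail_convex a a"
  by (auto simp: tail_convex_def intro!: hull_inc)

lemma tail_convex_hull_subset: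
  assumes "tail_convex b a"
  shows "convex hull (b ` {n..}) \<subseteq> convex hull (a ` {n..})"
proof (rule hull_minimal)
  show "b ` {n..} \<subseteq> convex hull (a ` {n..})"
  proof (rule image_subsetI)
    fix m assume "m \<in> {n..}"
    then have "convex hull (a ` {m..}) \<subseteq> convex hull (a ` {n..})"
      by (intro hull_mono image_mono) auto
    then show "b m \<in> convex hull (a ` {n..})"
      using assms unfolding tail_convex_def by blast
  qed
qed simp

lemma tail_convex_trans: "tail_convex c b \<Longrightarrow> tail_convex b a \<Longrightarrow> tail_convex c a"
  using tail_convex_hull_subset unfolding tail_convex_def by blast

lemma tail_convex_midpoint:
  assumes "\<And>n. n \<le> l n" "\<And>n. n \<le> h n"
  shows "tail_convex (\<lambda>n. (1/2) *\<^sub>R (b (l n) + b (h n))) b"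
  unfolding tail_convex_def scaleR_add_right
  by (intro allI convexD[OF convex_convex_hull] hull_inc) (use assms in auto)

lemma tail_convex_in_J_set:
  assumes "x \<noteq> 0" "\<And>n. a n \<in> J_set x" "tail_convex b a"
  shows "b n \<in> J_set x"
proof -
  have "convex hull (a ` {n..}) \<subseteq> J_set x"
    using assms by (intro hull_minimal convex_J_set) auto
  with assms(3) show ?thesis
    unfolding tail_convex_def by blast
qed

text \<open>
  Arbitrarily late values of \<open>b\<close> at the point \<open>y\<close> of the unit ball differ by at least \<open>\<delta>\<close>.
  Real parts suffice, since \<open>y\<close> may be multiplied by \<open>\<i>\<close>.
\<close>
definition oscillates :: "real \<Rightarrow> (nat \<Rightarrow> 'a::complex_banach \<Rightarrow>\<^sub>L complex) \<Rightarrow> 'a \<Rightarrow> bool"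
  where "oscillates \<delta> b y \<longleftrightarrow> norm y \<le> 1 \<and>
    (\<forall>n. \<exists>l\<ge>n. \<exists>h\<ge>n. \<delta> \<le> Re (blinfun_apply (b h) y - blinfun_apply (b l) y))"

lemma cmod_half_parallelogram:
  "(cmod ((q - p) / 2))\<^sup>2 + (cmod ((p + q) / 2))\<^sup>2 = ((cmod p)\<^sup>2 + (cmod q)\<^sup>2) / 2"
proof -
  have "((b - a) / 2)\<^sup>2 + ((a + b) / 2)\<^sup>2 = (a\<^sup>2 + b\<^sup>2) / 2" for a b :: real
    by (simp add: power2_eq_square field_simps)
  from this[of "Re q" "Re p"] this[of "Im q" "Im p"] show ?thesis
    unfolding cmod_power2 by simp
qed

lemma cmod_midpoint_le: "(cmod ((p + q) / 2))\<^sup>2 \<le> ((cmod p)\<^sup>2 + (cmod q)\<^sup>2) / 2"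
  using cmod_half_parallelogram[of q p] zero_le_power2[of "cmod ((q - p) / 2)"] by linarith

text \<open>
  The Rademacher construction. Below, \<open>A K\<close> is the sequence after \<open>K\<close> averaging steps, and \<open>D K k\<close>
  is obtained by the same steps except that in step \<open>k\<close> the upper index is taken instead of the
  midpoint. Thus \<open>D K k n - A K n\<close> is the \<open>k\<close>-th Rademacher coefficient of the family of which \<open>A K n\<close>
  is the mean.

  The choice of \<open>y\<close> in step \<open>k\<close> must not depend on the later steps, as the lower bound there has to
  survive the limit \<open>K \<rightarrow> \<infinity>\<close>. This is why all members of the family share one \<open>y\<close>, and it suffices
  that their average oscillates there.
\<close>
lemma ddagger_no_persistent_oscillation:
  fixes a :: "nat \<Rightarrow> 'a::complex_banach \<Rightarrow>\<^sub>L complex"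
  assumes dd: "property_ddagger TYPE('a)" and x: "norm x = 1" and \<delta>: "\<delta> > 0"
    and a: "\<And>n. a n \<in> J_set x"
    and osc: "\<And>b. tail_convex b a \<Longrightarrow> \<exists>y. oscillates \<delta> b y"
  shows False
proof -
  have x0: "x \<noteq> 0" using x by auto
  have "\<forall>b. \<exists>y lo hi. tail_convex b a \<longrightarrow> norm y \<le> 1 \<and> (\<forall>n. n \<le> lo n \<and> n \<le> hi n \<and>
      \<delta> \<le> Re (blinfun_apply (b (hi n)) y - blinfun_apply (b (lo n)) y))"
  proof
    fix b
    show "\<exists>y lo hi. tail_convex b a \<longrightarrow> norm y \<le> 1 \<and> (\<forall>n. n \<le> lo n \<and> n \<le> hi n \<and>
      \<delta> \<le> Re (blinfun_apply (b (hi n)) y - blinfun_apply (b (lo n)) y))"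
    proof (cases "tail_convex b a")
      case True
      then obtain y where "norm y \<le> 1"
        "\<forall>n. \<exists>l h. n \<le> l \<and> n \<le> h \<and> \<delta> \<le> Re (blinfun_apply (b h) y - blinfun_apply (b l) y)"
        using osc unfolding oscillates_def by meson
      then show ?thesis by metis
    qed simp
  qed
  then obtain Y LO HI where Y: "\<And>b. tail_convex b a \<Longrightarrow> norm (Y b) \<le> 1"
    and LO: "\<And>b n. tail_convex b a \<Longrightarrow> n \<le> LO b n"
    and HI: "\<And>b n. tail_convex b a \<Longrightarrow> n \<le> HI b n"
    and gap: "\<And>b n. tail_convex b a \<Longrightarrow>
      \<delta> \<le> Re (blinfun_apply (b (HI b n)) (Y b) - blinfun_apply (b (LO b n)) (Y b))"
    by metis
  define A where "A = rec_nat a (\<lambda>_ b n. (1/2) *\<^sub>R (b (LO b n) + b (HI b n)))"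
  (* For k \<ge> K the value of D K k is irrelevant; it only has to stay in the face. *)
  define D where "D = rec_nat (\<lambda>_. a) (\<lambda>K d k n. if k = K then A K (HI (A K) n)
    else (1/2) *\<^sub>R (d k (LO (A K) n) + d k (HI (A K) n)))"
  have A_0: "A 0 = a" and A_Suc: "A (Suc K) n = (1/2) *\<^sub>R (A K (LO (A K) n) + A K (HI (A K) n))" for K n
    by (simp_all add: A_def)
  have D_0: "D 0 k = a" and D_new: "D (Suc K) K n = A K (HI (A K) n)"
    and D_old: "k \<noteq> K \<Longrightarrow> D (Suc K) k n = (1/2) *\<^sub>R (D K k (LO (A K) n) + D K k (HI (A K) n))" for K k n
    by (simp_all add: D_def)
  have tc: "tail_convex (A K) a" for K
  proof (induction K)
    case (Suc K)
    have "tail_convex (A (Suc K)) (A K)"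
      using tail_convex_midpoint[of "LO (A K)" "HI (A K)" "A K"] LO[OF Suc] HI[OF Suc] by (simp add: A_Suc[abs_def])
    then show ?case
      using Suc tail_convex_trans by blast
  qed (simp add: A_0 tail_convex_refl)
  have AJ: "A K n \<in> J_set x" for K n
    by (rule tail_convex_in_J_set[OF x0 a tc])
  have DJ: "D K k n \<in> J_set x" for K k n
  proof (induction K arbitrary: n)
    case (Suc K)
    then show ?case
      using convexD[OF convex_J_set[OF x0] Suc Suc, of "1/2" "1/2"]
      by (cases "k = K") (auto simp: D_new AJ D_old scaleR_add_right)
  qed (simp add: D_0 a)
  (* Bessel's inequality for the orthonormal system of the constant 1 and the first K Rademacher
     functions. It is preserved by a further averaging step because midpoints do not increase the
     sum of squares of the old coefficients, while the parallelogram law accounts for the new one. *)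
  have bessel: "(\<Sum>k<K. (cmod (blinfun_apply (D K k n) y - blinfun_apply (A K n) y))\<^sup>2)
      + (cmod (blinfun_apply (A K n) y))\<^sup>2 \<le> (norm y)\<^sup>2" for K n y
  proof (induction K arbitrary: n)
    case 0
    show ?case
      using J_set_bound[OF AJ[of 0 n], of y] by (simp add: power_mono)
  next
    case (Suc K)
    let ?l = "LO (A K) n" and ?h = "HI (A K) n"
    let ?r = "\<lambda>k m. blinfun_apply (D K k m) y - blinfun_apply (A K m) y"
    let ?a = "\<lambda>m. blinfun_apply (A K m) y"
    have "blinfun_apply (D (Suc K) k n) y - blinfun_apply (A (Suc K) n) y = (?r k ?l + ?r k ?h) / 2"
      if "k < K" for k
      using that by (simp add: D_old A_Suc blinfun.add_left blinfun.scaleR_left scaleR_conv_of_real field_simps)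
    then have "(\<Sum>k<K. (cmod (blinfun_apply (D (Suc K) k n) y - blinfun_apply (A (Suc K) n) y))\<^sup>2)
        \<le> (\<Sum>k<K. ((cmod (?r k ?l))\<^sup>2 + (cmod (?r k ?h))\<^sup>2) / 2)"
      by (intro sum_mono) (simp only: lessThan_iff cmod_midpoint_le)
    also have "\<dots> = ((\<Sum>k<K. (cmod (?r k ?l))\<^sup>2) + (\<Sum>k<K. (cmod (?r k ?h))\<^sup>2)) / 2"
      by (simp add: sum.distrib flip: sum_divide_distrib)
    finally have old: "(\<Sum>k<K. (cmod (blinfun_apply (D (Suc K) k n) y - blinfun_apply (A (Suc K) n) y))\<^sup>2)
        \<le> ((\<Sum>k<K. (cmod (?r k ?l))\<^sup>2) + (\<Sum>k<K. (cmod (?r k ?h))\<^sup>2)) / 2" .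
    have "blinfun_apply (D (Suc K) K n) y - blinfun_apply (A (Suc K) n) y = (?a ?h - ?a ?l) / 2"
      "blinfun_apply (A (Suc K) n) y = (?a ?l + ?a ?h) / 2"
      by (simp_all add: D_new A_Suc blinfun.add_left blinfun.scaleR_left scaleR_conv_of_real field_simps)
    then have "(cmod (blinfun_apply (D (Suc K) K n) y - blinfun_apply (A (Suc K) n) y))\<^sup>2
        + (cmod (blinfun_apply (A (Suc K) n) y))\<^sup>2 = ((cmod (?a ?l))\<^sup>2 + (cmod (?a ?h))\<^sup>2) / 2"
      by (simp only: cmod_half_parallelogram)
    moreover have "s + r + a \<le> N"
      if "r + a = (c + d) / 2" "s \<le> (p + q) / 2" "p + c \<le> N" "q + d \<le> N" for s r a c d p q N :: real
      using that by (simp add: field_simps)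
    ultimately show ?case
      unfolding sum.lessThan_Suc using old Suc[of ?l] Suc[of ?h] by blast
  qed
  have gap_D: "\<delta> / 2 \<le> Re (blinfun_apply (D K k n) (Y (A k)) - blinfun_apply (A K n) (Y (A k)))"
    if "k < K" for K k n
    using that
  proof (induction K arbitrary: n)
    case (Suc K)
    show ?case
    proof (cases "k = K")
      case True
      then show ?thesis
        using gap[OF tc[of K], of n]
        by (simp add: D_new A_Suc blinfun.add_left blinfun.scaleR_left field_simps)
    next
      case False
      then show ?thesis
        using Suc.IH[of "LO (A K) n"] Suc.IH[of "HI (A K) n"] Suc.prems
        by (simp add: D_old A_Suc blinfun.add_left blinfun.scaleR_left field_simps)
    qed
  qed simp
  (* The mean and all conditioned means are collected into one family, so that a single filter
     makes all of them converge. *)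
  define G where "G K i = (case i of 0 \<Rightarrow> A K 0 | Suc k \<Rightarrow> D K k 0)" for K i
  have "G K i \<in> J_set x" for K i
    by (simp add: G_def AJ DJ split: nat.split)
  then obtain F L where F: "F \<le> sequentially" "F \<noteq> bot" and LJ: "\<And>i. L i \<in> J_set x"
    and lim: "\<And>i y. ((\<lambda>K. blinfun_apply (G K i) y) \<longlongrightarrow> blinfun_apply (L i) y) F"
    using J_set_weak_star_compact[OF x0, of G] by metis
  have ev: "eventually (\<lambda>K. m \<le> K) F" for m
    using F(1) eventually_ge_at_top[of m] by (rule filter_leD)
  have limA: "((\<lambda>K. blinfun_apply (A K 0) y) \<longlongrightarrow> blinfun_apply (L 0) y) F" for y
    using lim[where i = 0] by (simp add: G_def)
  have limD: "((\<lambda>K. blinfun_apply (D K k 0) y) \<longlongrightarrow> blinfun_apply (L (Suc k)) y) F" for k y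
    using lim[where i = "Suc k"] by (simp add: G_def)
  have "(\<lambda>k. blinfun_apply (L (Suc k)) y) \<longlonglongrightarrow> blinfun_apply (L 0) y" for y
  proof -
    let ?s = "\<lambda>k. (cmod (blinfun_apply (L (Suc k)) y - blinfun_apply (L 0) y))\<^sup>2"
    have "(\<Sum>k<m. ?s k) \<le> (norm y)\<^sup>2" for m
    proof (rule tendsto_upperbound)
      show "((\<lambda>K. \<Sum>k<m. (cmod (blinfun_apply (D K k 0) y - blinfun_apply (A K 0) y))\<^sup>2) \<longlongrightarrow> (\<Sum>k<m. ?s k)) F"
        by (intro tendsto_intros limA limD)
      show "\<forall>\<^sub>F K in F. (\<Sum>k<m. (cmod (blinfun_apply (D K k 0) y - blinfun_apply (A K 0) y))\<^sup>2) \<le> (norm y)\<^sup>2"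
        using ev[of m]
      proof eventually_elim
        case (elim K)
        then have "(\<Sum>k<m. (cmod (blinfun_apply (D K k 0) y - blinfun_apply (A K 0) y))\<^sup>2)
            \<le> (\<Sum>k<K. (cmod (blinfun_apply (D K k 0) y - blinfun_apply (A K 0) y))\<^sup>2)"
          by (intro sum_mono2) auto
        then show ?case
          using bessel[of K 0 y] zero_le_power2[of "cmod (blinfun_apply (A K 0) y)"] by linarith
      qed
    qed (rule F(2))
    then have "summable ?s"
      by (intro summableI_nonneg_bounded) auto
    then have "(\<lambda>k. sqrt (?s k)) \<longlonglongrightarrow> sqrt 0"
      by (intro tendsto_real_sqrt summable_LIMSEQ_zero)
    then show ?thesis
      by (simp add: tendsto_norm_zero_iff LIM_zero_iff)
  qed
  then have "(\<lambda>k. L (Suc k)) \<longlonglongrightarrow> L 0"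
    by (rule ddagger_weak_star_imp_norm[OF dd x LJ LJ])
  then obtain k where k: "norm (L (Suc k) - L 0) < \<delta> / 2"
    using \<delta> unfolding LIMSEQ_iff by (meson half_gt_zero order_refl)
  have "\<delta> / 2 \<le> Re (blinfun_apply (L (Suc k)) (Y (A k)) - blinfun_apply (L 0) (Y (A k)))"
  proof (rule tendsto_lowerbound)
    show "((\<lambda>K. Re (blinfun_apply (D K k 0) (Y (A k)) - blinfun_apply (A K 0) (Y (A k))))
        \<longlongrightarrow> Re (blinfun_apply (L (Suc k)) (Y (A k)) - blinfun_apply (L 0) (Y (A k)))) F"
      by (intro tendsto_intros limA limD)
    show "\<forall>\<^sub>F K in F. \<delta> / 2 \<le> Re (blinfun_apply (D K k 0) (Y (A k)) - blinfun_apply (A K 0) (Y (A k)))"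
      using ev[of "Suc k"] by eventually_elim (intro gap_D, simp)
  qed (rule F(2))
  also have "\<dots> \<le> cmod (blinfun_apply (L (Suc k) - L 0) (Y (A k)))"
    by (simp add: blinfun.diff_left complex_Re_le_cmod del: minus_complex.simps)
  also have "\<dots> \<le> norm (L (Suc k) - L 0) * norm (Y (A k))"
    by (rule norm_blinfun)
  also have "\<dots> \<le> norm (L (Suc k) - L 0)"
    using Y[OF tc] by (simp add: mult_left_le)
  finally show False
    using k by simp
qed

lemma oscillation_convex_hull:
  assumes "\<And>l h. n \<le> l \<Longrightarrow> n \<le> h \<Longrightarrow> Re (blinfun_apply (b h) y - blinfun_apply (b l) y) \<le> \<delta>"
    and "p \<in> convex hull (b ` {n..})" "q \<in> convex hull (b ` {n..})"
  shows "Re (blinfun_apply p y - blinfun_apply q y) \<le> \<delta>"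
proof -
  have lin: "linear (\<lambda>p. Re (blinfun_apply p y))"
    by (rule linearI) (simp_all add: blinfun.add_left blinfun.scaleR_left)
  have cv: "convex {p. Re (blinfun_apply p y) \<le> c}" "convex {p. c \<le> Re (blinfun_apply p y)}" for c
    using convex_linear_vimage[OF lin, of "{..c}"] convex_linear_vimage[OF lin, of "{c..}"]
    by (simp_all add: vimage_def)
  have "convex hull (b ` {n..}) \<subseteq> {p. Re (blinfun_apply p y) \<le> Re (blinfun_apply (b l) y) + \<delta>}"
    if "n \<le> l" for l
    using assms(1)[OF that] by (intro hull_minimal cv) force
  then have "convex hull (b ` {n..}) \<subseteq> {q. Re (blinfun_apply p y) - \<delta> \<le> Re (blinfun_apply q y)}"
    using assms(2) by (intro hull_minimal cv) force
  with assms(3) show ?thesis by force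
qed

text \<open>
  By the previous result the oscillation of convex combinations of \<open>f\<close> can be made arbitrarily small.
  From some index on, the diagonal sequence \<open>d\<close> consists of convex combinations of each of the
  sequences \<open>A i\<close>, so it inherits all their oscillation bounds and converges weak*.
  Its terms \<open>d j\<close> are convex combinations of finitely many \<open>f i\<close> with \<open>i \<ge> j\<close>, hence at distance 2
  from all terms that come late enough.
\<close>
lemma ddagger_no_disjoint_sequence:
  fixes f :: "nat \<Rightarrow> 'a::complex_banach \<Rightarrow>\<^sub>L complex"
  assumes dd: "property_ddagger TYPE('a)" and x: "norm x = 1"
    and f: "\<And>i. f i \<in> J_set x"
    and dist: "\<And>m p q. p \<in> convex hull (f ` {..<m}) \<Longrightarrow> q \<in> convex hull (f ` {m..}) \<Longrightarrow> norm (p - q) = 2"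
  shows False
proof -
  have x0: "x \<noteq> 0" using x by auto
  have "\<exists>b. tail_convex b a \<and> (\<forall>y. \<not> oscillates \<delta> b y)" if "\<delta> > 0" "tail_convex a f" for \<delta> a
  proof (rule ccontr)
    assume "\<not> ?thesis"
    then have "\<And>b. tail_convex b a \<Longrightarrow> \<exists>y. oscillates \<delta> b y"
      by blast
    from ddagger_no_persistent_oscillation[OF dd x that(1) _ this] show False
      using tail_convex_in_J_set[OF x0 f that(2)] by blast
  qed
  then have "\<exists>A. \<forall>n. tail_convex (A n) f \<and>
      (tail_convex (A (Suc n)) (A n) \<and> (\<forall>y. \<not> oscillates (1 / Suc n) (A (Suc n)) y))"
    by (intro dependent_nat_choice)
      (use tail_convex_refl in blast, metis of_nat_0_less_iff tail_convex_trans zero_less_Suc zero_less_divide_1_iff)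
  then obtain A where Af: "\<And>n. tail_convex (A n) f" and AS: "\<And>n. tail_convex (A (Suc n)) (A n)"
    and Aosc: "\<And>n y. \<not> oscillates (1 / Suc n) (A (Suc n)) y"
    by blast
  have AA: "tail_convex (A j) (A i)" if "i \<le> j" for i j
    using that by (induction j rule: dec_induct) (use tail_convex_refl AS tail_convex_trans in blast)+
  define d where "d j = A j j" for j
  have dA: "d j \<in> convex hull (A i ` {n..})" if "i \<le> j" "n \<le> j" for i j n
  proof -
    have "convex hull (A i ` {j..}) \<subseteq> convex hull (A i ` {n..})"
      using that by (intro hull_mono image_mono) auto
    with AA[OF that(1)] show ?thesis
      unfolding tail_convex_def d_def by blast
  qed
  have df: "d j \<in> convex hull (f ` {j..})" for j
    using Af[of j] by (simp add: tail_convex_def d_def)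
  have dJ: "d j \<in> J_set x" for j
    unfolding d_def by (rule tail_convex_in_J_set[OF x0 f Af])
  have conv_ball: "convergent (\<lambda>j. Re (blinfun_apply (d j) y))" if y: "norm y \<le> 1" for y
  proof -
    have "\<exists>M. \<forall>j\<ge>M. \<forall>k\<ge>M. \<bar>Re (blinfun_apply (d j) y) - Re (blinfun_apply (d k) y)\<bar> < \<eta>"
      if \<eta>: "\<eta> > 0" for \<eta>
    proof -
      obtain i where i: "1 / Suc i < \<eta>"
        using nat_approx_posE[OF \<eta>] by blast
      obtain n where n: "\<And>l h. n \<le> l \<Longrightarrow> n \<le> h \<Longrightarrow>
          Re (blinfun_apply (A (Suc i) h) y - blinfun_apply (A (Suc i) l) y) \<le> 1 / Suc i"
        using Aosc[of i y] y unfolding oscillates_def by (meson linorder_linear)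
      have "Re (blinfun_apply (d j) y - blinfun_apply (d k) y) \<le> 1 / Suc i"
        if "max n (Suc i) \<le> j" "max n (Suc i) \<le> k" for j k
        by (rule oscillation_convex_hull[OF n dA dA]) (use that in auto)
      then have "Re (blinfun_apply (d j) y) - Re (blinfun_apply (d k) y) < \<eta>"
        if "max n (Suc i) \<le> j" "max n (Suc i) \<le> k" for j k
        using that i by fastforce
      then show ?thesis
        by (intro exI[of _ "max n (Suc i)"]) (simp add: abs_less_iff)
    qed
    then have "Cauchy (\<lambda>j. Re (blinfun_apply (d j) y))"
      unfolding Cauchy_def dist_real_def by blast
    then show ?thesis
      by (rule Cauchy_convergent)
  qed
  have conv_Re: "convergent (\<lambda>j. Re (blinfun_apply (d j) y))" for y
  proof (cases "y = 0")
    case False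
    have "convergent (\<lambda>j. norm y * Re (blinfun_apply (d j) (sgn y)))"
      by (intro convergent_mult convergent_const conv_ball) (simp add: norm_sgn)
    with False show ?thesis
      by (simp add: sgn_div_norm blinfun.scaleR_right flip: mult.assoc)
  qed (simp add: convergent_const)
  obtain F L where F: "F \<le> sequentially" "F \<noteq> bot" and LJ: "\<And>i. L i \<in> J_set x"
    and lim: "\<And>(i::unit) y. ((\<lambda>K. blinfun_apply (d K) y) \<longlongrightarrow> blinfun_apply (L i) y) F"
    using J_set_weak_star_compact[OF x0, of "\<lambda>K _. d K"] dJ by metis
  have lim_Re: "(\<lambda>j. Re (blinfun_apply (d j) y)) \<longlonglongrightarrow> Re (blinfun_apply (L ()) y)" for y
  proof -
    obtain r where r: "(\<lambda>j. Re (blinfun_apply (d j) y)) \<longlonglongrightarrow> r"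
      using conv_Re unfolding convergent_def by blast
    with tendsto_unique[OF F(2) tendsto_mono[OF F(1) r] tendsto_Re[OF lim[of y "()"]]] show ?thesis
      by simp
  qed
  have "(\<lambda>j. blinfun_apply (d j) y) \<longlonglongrightarrow> blinfun_apply (L ()) y" for y
  proof -
    have "- Re (blinfun_apply \<phi> (\<i> *\<^sub>C y)) = Im (blinfun_apply \<phi> y)" if "\<phi> \<in> J_set x" for \<phi>
      using that by (simp add: J_set_def dual_scaleC_apply)
    then have "(\<lambda>j. Im (blinfun_apply (d j) y)) \<longlonglongrightarrow> Im (blinfun_apply (L ()) y)"
      using tendsto_minus[OF lim_Re[of "\<i> *\<^sub>C y"]] dJ LJ by simp
    then show ?thesis
      using lim_Re[of y] by (simp add: tendsto_complex_iff)
  qed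
  then have "d \<longlonglongrightarrow> L ()"
    by (rule ddagger_weak_star_imp_norm[OF dd x dJ LJ])
  then have "Cauchy d"
    by (rule LIMSEQ_imp_Cauchy)
  then obtain N where N: "\<And>j k. N \<le> j \<Longrightarrow> N \<le> k \<Longrightarrow> norm (d j - d k) < 1"
    unfolding Cauchy_iff by (metis zero_less_one)
  (* A convex combination involves finitely many terms only. *)
  have "\<exists>m. d N \<in> convex hull (f ` {..<m})"
  proof -
    obtain S u where S: "finite S" "S \<subseteq> f ` {N..}"
      and u: "\<forall>v\<in>S. 0 \<le> u v" "sum u S = 1" "(\<Sum>v\<in>S. u v *\<^sub>R v) = d N"
      using df[of N] unfolding convex_hull_explicit by blast
    obtain I where I: "finite I" "S = f ` I"
      using finite_subset_image[OF S] by blast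
    obtain m where "I \<subseteq> {..<m}"
      using I(1) finite_nat_iff_bounded by blast
    then have "S \<subseteq> f ` {..<m}"
      using I by blast
    then show ?thesis
      using S u unfolding convex_hull_explicit by blast
  qed
  then obtain m where m: "d N \<in> convex hull (f ` {..<m})" ..
  have "convex hull (f ` {max m N..}) \<subseteq> convex hull (f ` {m..})"
    by (intro hull_mono image_mono) auto
  then have "norm (d N - d (max m N)) = 2"
    using dist[OF m] df by blast
  with N[of N "max m N"] show False
    by simp
qed

section \<open>Smoothness\<close>

text \<open>
  Hahn--Banach enters here: only because the face is nonempty is the dimension positive.
\<close>

lemma k_smooth_point_if_finite_dim:
  assumes x: "x \<noteq> 0" and fin: "finite_dim (J_set x)"
  shows "\<exists>k>0. k_smooth_point k x"
proof -
  obtain F where F: "finite F" "J_set x \<subseteq> complex_vector.span F"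
    using fin unfolding finite_dim_def by blast
  obtain B where B: "B \<subseteq> J_set x" "\<not> complex_vector.dependent B" "J_set x \<subseteq> complex_vector.span B"
    using complex_vector.maximal_independent_subset by blast
  have "finite B"
    using complex_vector.independent_span_bound[OF F(1) B(2)] B(1) F(2) by blast
  have span: "complex_vector.span B = complex_vector.span (J_set x)"
    using B complex_vector.span_mono[OF B(1)]
      complex_vector.span_minimal[OF B(3) complex_vector.subspace_span] by blast
  have dim: "complex_vector.dim (complex_vector.span (J_set x)) = card B"
    using complex_vector.dim_eq_card[OF span B(2)] by simp
  obtain \<phi> where \<phi>: "\<phi> \<in> J_set x"
    using J_set_nonempty[OF x] by blast
  have "B \<noteq> {}"
  proof
    assume "B = {}"
    with B(3) \<phi> have "\<phi> = 0" by auto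
    with \<phi> show False by (simp add: J_set_def)
  qed
  with \<open>finite B\<close> have "card B > 0"
    by (simp add: card_gt_0_iff)
  moreover have "k_smooth_point (card B) x"
    unfolding k_smooth_point_def using x \<open>finite B\<close> span dim by blast
  ultimately show ?thesis by blast
qed

theorem theorem23:
  fixes M :: "'b measure"
  assumes "L1_predual TYPE('a::complex_banach) M"
    and "property_ddagger TYPE('a)"
  shows "\<forall>x\<in>sphere (0::'a) 1. \<exists>k>0. k_smooth_point k x"
proof
  fix x :: 'a assume "x \<in> sphere 0 1"
  then have x: "norm x = 1" "x \<noteq> 0" by auto
  obtain T :: "('a \<Rightarrow>\<^sub>L complex) \<Rightarrow> ('b \<Rightarrow> complex) set" where T: "dual_L1_isometry M T"
    using assms(1) unfolding L1_predual_def by blast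
  have "finite_dim (J_set x)"
  proof (rule ccontr)
    assume inf: "\<not> finite_dim (J_set x)"
    show False
      by (rule disjoint_sequence_in_J[OF T x(2) inf], rule ddagger_no_disjoint_sequence[OF assms(2) x(1)])
  qed
  then show "\<exists>k>0. k_smooth_point k x"
    by (rule k_smooth_point_if_finite_dim[OF x(2)])
qed

end
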